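(* There exists a constant $c_{3,5}>0$ such that $R(C_5^3,K_n^3)\leq c_{3,5}\,n^{4/3}$ for all $n$. More generally, for every fixed integer $l\geq 3$ there exists a constant $c_{3,l}>0$ such that for all $n$, $$R(C_l^3,K_n^3)\leq c_{3,l}\, n^{1+1/\lfloor (l+1)/2\rfloor}.$$
   Context: A loose cycle of length $l$ is a hypergraph with $l$ edges $e_1,\dots,e_l$ such that $|e_i\cap e_j|=1$ whenever $j\equiv i+1$ or $j\equiv i-1 \pmod l$, and $e_i\cap e_j=\emptyset$ otherwise. $C_l^r$ denotes an $r$-uniform loose cycle of length $l$ (all edges have size $r$), and $K_n^r$ denotes the complete $r$-uniform hypergraph on $n$ vertices. The Ramsey number $R(C_l^r,K_n^r)$ is the least integer $N$ such that every red/blue colouring of the edges of $K_N^r$ contains a red copy of $C_l^r$ or a blue copy of $K_n^r$. *)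

theory Defs
  imports Complex_Main "HOL-Library.Ramsey"
begin

text \<open>
  A hypergraph without isolated vertices is identified with its edge set. For \<open>l \<ge> 4\<close> the last
  conjunct follows from the others (see \<open>loose_cycle_no_common_vertex\<close> below); for \<open>l = 3\<close>
  it is the usual requirement that singles out the loose triangle, excluding three edges through
  one common vertex, so that all \<open>r\<close>-uniform loose cycles of length \<open>l\<close> are isomorphic.
\<close>

definition loose_cycle :: "nat \<Rightarrow> nat \<Rightarrow> 'a set set \<Rightarrow> bool" where
  "loose_cycle r l E \<longleftrightarrow>
     (\<exists>e. E = e ` {..<l} \<and> inj_on e {..<l} \<and>
          (\<forall>i<l. finite (e i) \<and> card (e i) = r) \<and>
          (\<forall>i<l. \<forall>j<l. i \<noteq> j \<longrightarrow>
             (if j = Suc i mod l \<or> i = Suc j mod l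
              then card (e i \<inter> e j) = 1 else e i \<inter> e j = {})) \<and>
          (\<Inter>i<l. e i) = {})"

text \<open>
  A colouring of the edges of \<open>K\<^sub>N\<^sup>r\<close> is given by its set of red edges; the other
  \<open>r\<close>-subsets of the vertex set are blue.
\<close>

definition cycle_clique_arrows :: "nat \<Rightarrow> nat \<Rightarrow> nat \<Rightarrow> nat \<Rightarrow> bool" where
  "cycle_clique_arrows r l n N \<longleftrightarrow>
     (\<forall>red \<subseteq> [{..<N}]\<^bsup>r\<^esup>.
        (\<exists>C \<subseteq> red. loose_cycle r l C) \<or>
        (\<exists>S \<subseteq> {..<N}. card S = n \<and> [S]\<^bsup>r\<^esup> \<subseteq> [{..<N}]\<^bsup>r\<^esup> - red))"

definition ramsey_cycle_clique :: "nat \<Rightarrow> nat \<Rightarrow> nat \<Rightarrow> nat" where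
  "ramsey_cycle_clique r l n = (LEAST N. cycle_clique_arrows r l n N)"

lemma loose_cycle_no_common_vertex:
  fixes e :: "nat \<Rightarrow> 'a set"
  assumes "l \<ge> 4"
    and inter: "\<forall>i<l. \<forall>j<l. i \<noteq> j \<longrightarrow>
             (if j = Suc i mod l \<or> i = Suc j mod l
              then card (e i \<inter> e j) = 1 else e i \<inter> e j = {})"
  shows "(\<Inter>i<l. e i) = {}"
proof -
  have "e 0 \<inter> e 2 = {}"
    using inter[rule_format, of 0 2] \<open>l \<ge> 4\<close> by (simp split: if_splits)
  moreover have "(\<Inter>i<l. e i) \<subseteq> e 0 \<inter> e 2"
    using \<open>l \<ge> 4\<close> by auto
  ultimately show ?thesis by blast
qed

lemma loose_cycle_in_clique:
  assumes "l \<ge> 3" "finite H" "card H = 2 * l"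
  shows "\<exists>C \<subseteq> [H]\<^bsup>3\<^esup>. loose_cycle 3 l C"
proof -
  obtain g where g: "bij_betw g {0..<2*l} H"
    using assms ex_bij_betw_nat_finite by metis
  define s where "s i = Suc i mod l" for i
  define v where "v i = {2*i, 2*i+1, 2 * s i}" for i
  define e where "e i = g ` v i" for i
  have s_less: "s i < l" for i using assms by (simp add: s_def)
  have s_eq: "s i = (if Suc i = l then 0 else Suc i)" if "i < l" for i
    using that by (auto simp: s_def)
  have s_ne: "s i \<noteq> i" if "i < l" for i
    using that assms by (auto simp: s_eq)
  have s_s: "s (s i) \<noteq> i" if "i < l" for i
    using that assms s_less[of i] by (auto simp: s_eq split: if_splits)
  have s_inj: "s i = s j \<Longrightarrow> i = j" if "i < l" "j < l" for i j
    using that by (auto simp: s_eq split: if_splits)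
  have v_sub: "v i \<subseteq> {0..<2*l}" if "i < l" for i
    using that s_less[of i] by (auto simp: v_def)
  have ginj: "inj_on g {0..<2*l}" and gH: "g ` {0..<2*l} = H"
    using g by (auto simp: bij_betw_def)
  have card_v: "card (v i) = 3" if "i < l" for i
  proof -
    have "2 * s i \<noteq> 2*i+1" by presburger
    with s_ne[OF that] show ?thesis by (simp add: v_def eval_nat_numeral)
  qed
  have e_int: "e i \<inter> e j = g ` (v i \<inter> v j)" if "i < l" "j < l" for i j
    using inj_on_image_Int[OF ginj v_sub[OF that(1)] v_sub[OF that(2)]] by (simp add: e_def)
  have card_g: "card (g ` X) = card X" if "X \<subseteq> {0..<2*l}" for X
    using that ginj by (metis card_image inj_on_subset)
  have v_succ: "v i \<inter> v (s i) = {2 * s i}" if "i < l" for i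
  proof -
    have odd: "2*a \<noteq> Suc (2*b)" "Suc (2*b) \<noteq> 2*a" for a b :: nat by presburger+
    show ?thesis
      using s_ne[OF that] s_s[OF that] s_ne[OF s_less[of i]] odd by (auto simp: v_def)
  qed
  have v_far: "v i \<inter> v j = {}" if "i < l" "j < l" "i \<noteq> j" "j \<noteq> s i" "i \<noteq> s j" for i j
  proof -
    have odd: "2*a \<noteq> Suc (2*b)" "Suc (2*b) \<noteq> 2*a" for a b :: nat by presburger+
    show ?thesis using that s_inj[OF that(1,2)] odd by (auto simp: v_def)
  qed
  have card_e: "finite (e i) \<and> card (e i) = 3" if "i < l" for i
    using card_g[OF v_sub[OF that]] card_v[OF that] by (simp add: e_def v_def)
  have inter: "if j = Suc i mod l \<or> i = Suc j mod l
              then card (e i \<inter> e j) = 1 else e i \<inter> e j = {}"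
    if ij: "i < l" "j < l" "i \<noteq> j" for i j
  proof -
    have c: "card (e i \<inter> e (s i)) = 1" if "i < l" for i
      using e_int[OF that s_less] v_succ[OF that] by simp
    show ?thesis
      using c[OF ij(1)] c[OF ij(2)] e_int[OF ij(1,2)] v_far[OF ij]
      by (auto simp: s_def Int_commute)
  qed
  have inj: "inj_on e {..<l}"
  proof (rule inj_onI)
    fix i j assume ij: "i \<in> {..<l}" "j \<in> {..<l}" "e i = e j"
    show "i = j"
    proof (rule ccontr)
      assume "i \<noteq> j"
      then have "card (e i \<inter> e j) \<le> 1"
        using inter[of i j] ij by (auto split: if_splits)
      then show False using card_e[of i] ij by simp
    qed
  qed
  have empty: "(\<Inter>i<l. e i) = {}"
  proof -
    have "(v 0 \<inter> v 1) \<inter> (v 1 \<inter> v 2) = {}"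
      using v_succ[of 0] v_succ[of 1] assms by (simp add: s_eq numeral_2_eq_2)
    then have "v 0 \<inter> v 1 \<inter> v 2 = {}" by blast
    moreover have "e 0 \<inter> e 1 \<inter> e 2 = g ` (v 0 \<inter> v 1 \<inter> v 2)"
    proof -
      have "v 0 \<inter> v 1 \<subseteq> {0..<2*l}" "v 2 \<subseteq> {0..<2*l}"
        using v_sub[of 0] v_sub[of 2] assms by auto
      from inj_on_image_Int[OF ginj this] show ?thesis
        using e_int[of 0 1] assms by (simp add: e_def)
    qed
    moreover have "(\<Inter>i<l. e i) \<subseteq> e 0 \<inter> e 1 \<inter> e 2"
      using assms by auto
    ultimately show ?thesis by blast
  qed
  have "e ` {..<l} \<subseteq> [H]\<^bsup>3\<^esup>"
    using card_e v_sub gH unfolding nsets_def e_def by blast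
  moreover have "loose_cycle 3 l (e ` {..<l})"
    unfolding loose_cycle_def using inj card_e inter empty by blast
  ultimately show ?thesis by blast
qed

text \<open>The set whose least element defines the Ramsey number is nonempty.\<close>

lemma ramsey_cycle_clique_exists:
  assumes "l \<ge> 3"
  shows "\<exists>N. cycle_clique_arrows 3 l n N"
proof -
  obtain N :: nat where N: "partn_lst {..<N} [2 * l, n] 3"
    using ramsey_full by blast
  have "cycle_clique_arrows 3 l n N"
    unfolding cycle_clique_arrows_def
  proof (intro allI impI)
    fix red assume "red \<subseteq> [{..<N}]\<^bsup>3\<^esup>"
    define f :: "nat set \<Rightarrow> nat" where "f x = (if x \<in> red then 0 else 1)" for x
    have "f \<in> [{..<N}]\<^bsup>3\<^esup> \<rightarrow> {..<2}" by (auto simp: f_def)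
    then obtain i H where i: "i < 2" and H: "H \<in> [{..<N}]\<^bsup>([2*l,n]!i)\<^esup>"
      and f: "f ` [H]\<^bsup>3\<^esup> \<subseteq> {i}"
      using partn_lstE[OF N, of f 2] by (auto simp: numeral_2_eq_2)
    have HN: "H \<subseteq> {..<N}" "finite H" "card H = [2*l,n]!i"
      using H by (auto simp: nsets_def)
    show "(\<exists>C \<subseteq> red. loose_cycle 3 l C) \<or>
          (\<exists>S \<subseteq> {..<N}. card S = n \<and> [S]\<^bsup>3\<^esup> \<subseteq> [{..<N}]\<^bsup>3\<^esup> - red)"
    proof (cases "i = 0")
      case True
      then obtain C where "C \<subseteq> [H]\<^bsup>3\<^esup>" "loose_cycle 3 l C"
        using loose_cycle_in_clique[OF assms HN(2)] HN(3) by auto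
      moreover have "[H]\<^bsup>3\<^esup> \<subseteq> red"
        using f True by (auto simp: f_def image_subset_iff split: if_splits)
      ultimately show ?thesis by blast
    next
      case False
      with i have i1: "i = 1" by simp
      have "[H]\<^bsup>3\<^esup> \<subseteq> [{..<N}]\<^bsup>3\<^esup> - red"
        using f i1 nsets_mono[OF HN(1), of 3]
        by (auto simp: f_def image_subset_iff split: if_splits)
      then show ?thesis using HN i1 by auto
    qed
  qed
  then show ?thesis by blast
qed

end

theory Submission
  imports Defs
begin

text \<open>
  Let \<open>H\<close> be a 3-graph on \<open>N\<close> vertices without a loose \<open>l\<close>-cycle, \<open>k = \<lfloor>(l+1)/2\<rfloor>\<close> and
  \<open>\<tau> \<approx> N\<^bsup>1/(k+1)\<^esup>\<close>; the claim is that \<open>H\<close> has an independent set of size of order \<open>N/\<tau>\<close>.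
  If a vertex set \<open>W\<close> spans at most \<open>|W| \<tau>\<^sup>2\<close> edges, a random colouring gives an independent
  set of size of order \<open>|W|/\<tau>\<close>. Otherwise some vertex has a first neighbourhood of size of order
  \<open>\<tau>\<^sup>2\<close> (not only \<open>\<tau>\<close>, which is what saves one level compared with graphs), and we grow breadth-first
  levels from it. For \<open>2i < l\<close> the absence of an \<open>l\<close>-cycle forces the \<open>i\<close>-th level to contain a
  positive proportion \<open>I\<close> that is independent, up to deleting \<open>O(|I|)\<close> vertices. Either all edges
  meeting \<open>I\<close> can be destroyed by deleting at most \<open>\<tau>|I|\<close> further vertices, and we keep \<open>I\<close> and
  recurse on the rest, or the next level is larger by a factor of order \<open>\<tau>\<close>. The second alternative
  cannot hold at all levels \<open>1, \<dots>, k - 1\<close>, since level \<open>k\<close> would have more than \<open>N\<close> vertices.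

  The difficulty in the first step is that many edges at a vertex need not yield a large
  neighbourhood whose vertices are joined by loose paths. It is overcome by assigning to every edge
  at least one pair that is light for only boundedly many edges.
\<close>

section \<open>Loose paths\<close>

text \<open>
  A loose path is given by its vertex list: the joints sit at even positions, and the
  inner vertex of each edge at the odd position between its two joints.
\<close>

definition loose_path :: "'a set set \<Rightarrow> 'a list \<Rightarrow> bool" where
  "loose_path H p \<longleftrightarrow> odd (length p) \<and>
     (\<forall>i. 2 * i + 2 < length p \<longrightarrow> {p ! (2 * i), p ! (2 * i + 1), p ! (2 * i + 2)} \<in> H)"

lemma loose_path_singleton: "loose_path H [x]"
  by (simp add: loose_path_def)

lemma loose_path_edge: "{x, w, y} \<in> H \<Longrightarrow> loose_path H [x, w, y]"
  by (simp add: loose_path_def less_Suc_eq)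

lemma loose_path_nonempty: "loose_path H p \<Longrightarrow> p \<noteq> []"
  by (auto simp: loose_path_def)

lemma loose_path_rev:
  assumes "loose_path H p"
  shows "loose_path H (rev p)"
proof -
  obtain m where m: "length p = 2 * m + 1"
    using assms by (auto simp: loose_path_def elim: oddE)
  have "{rev p ! (2 * i), rev p ! (2 * i + 1), rev p ! (2 * i + 2)} \<in> H"
    if "2 * i + 2 < length p" for i
  proof -
    \<comment> \<open>Edge \<open>i\<close> of the reversed list is edge \<open>j\<close> of
      \<open>p\<close> read backwards.\<close>
    define j where "j = m - i - 1"
    have i: "i + j + 1 = m" using that m by (simp add: j_def)
    have "rev p ! (2 * i) = p ! (2 * j + 2)" "rev p ! (2 * i + 1) = p ! (2 * j + 1)"
      "rev p ! (2 * i + 2) = p ! (2 * j)"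
      using that m i by (auto simp: rev_nth intro!: arg_cong[where f = "(!) p"])
    moreover have "{p ! (2 * j), p ! (2 * j + 1), p ! (2 * j + 2)} \<in> H"
      using assms m i by (auto simp: loose_path_def)
    ultimately show ?thesis by (simp add: insert_commute)
  qed
  then show ?thesis using assms by (simp add: loose_path_def)
qed

lemma loose_path_join:
  assumes p: "loose_path H p" and q: "loose_path H q" and "last p = hd q"
  shows "loose_path H (p @ tl q)"
proof -
  obtain m where m: "length p = 2 * m + 1"
    using p by (auto simp: loose_path_def elim: oddE)
  obtain m' where m': "length q = 2 * m' + 1"
    using q by (auto simp: loose_path_def elim: oddE)
  \<comment> \<open>The shared vertex is covered as well: position \<open>2 * m\<close> holds both
    \<open>last p\<close> and \<open>hd q\<close>.\<close>
  have at: "(p @ tl q) ! (2 * m + n) = q ! n" if "n < length q" for n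
  proof (cases n)
    case 0
    then show ?thesis
      using m m' assms(3) by (cases p rule: rev_cases; cases q) (auto simp: nth_append)
  next
    case (Suc n')
    then show ?thesis using m m' that by (simp add: nth_append nth_tl)
  qed
  have "{(p @ tl q) ! (2 * i), (p @ tl q) ! (2 * i + 1), (p @ tl q) ! (2 * i + 2)} \<in> H"
    if i: "2 * i + 2 < length (p @ tl q)" for i
  proof (cases "i < m")
    case True
    then have "2 * i + 2 < length p" using m by simp
    then show ?thesis using p by (auto simp: loose_path_def nth_append)
  next
    case False
    then obtain j where j: "i = m + j" using le_Suc_ex not_less by blast
    have "2 * j + 2 < length q" using i j m m' by simp
    moreover have "2 * i = 2 * m + 2 * j" "2 * i + 1 = 2 * m + (2 * j + 1)"
      "2 * i + 2 = 2 * m + (2 * j + 2)"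
      using j by simp_all
    ultimately show ?thesis
      using q at[of "2 * j"] at[of "2 * j + 1"] at[of "2 * j + 2"] by (simp add: loose_path_def)
  qed
  moreover have "odd (length (p @ tl q))" using m m' by simp
  ultimately show ?thesis unfolding loose_path_def by blast
qed

lemma loose_path_snoc:
  assumes "loose_path H p" "last p = x" "{x, w, y} \<in> H"
  shows "loose_path H (p @ [w, y])"
  using loose_path_join[OF assms(1) loose_path_edge[OF assms(3)]] assms(2) by simp

lemma loose_path_segment:
  assumes "loose_path H p" "2 * (s + L) < length p"
  shows "loose_path H (take (2 * L + 1) (drop (2 * s) p))"
proof -
  have "{p ! (2 * s + 2 * i), p ! (2 * s + (2 * i + 1)), p ! (2 * s + (2 * i + 2))} \<in> H"
    if "2 * i + 2 < 2 * L + 1" for i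
  proof -
    have "2 * (s + i) + 2 < length p" using that assms(2) by simp
    with assms(1) have "{p ! (2 * (s + i)), p ! (2 * (s + i) + 1), p ! (2 * (s + i) + 2)} \<in> H"
      unfolding loose_path_def by blast
    then show ?thesis by (simp add: algebra_simps)
  qed
  moreover have "length (take (2 * L + 1) (drop (2 * s) p)) = 2 * L + 1" using assms(2) by simp
  ultimately show ?thesis using assms(2) by (simp add: loose_path_def)
qed

text \<open>The vertex at the seam occurs at both ends of the list, so only the tail is distinct.
  Positions below \<open>2 * l\<close> index the vertices injectively, with
  \<open>p ! (2 * l) = p ! 0\<close>, and intersections of edges reduce to those of the index sets
  \<open>v i\<close>.\<close>

lemma closed_loose_path_imp_loose_cycle:
  assumes p: "loose_path H p" and len: "length p = 2 * l + 1" and "hd p = last p"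
    and dist: "distinct (tl p)" and l: "l \<ge> 3"
  shows "\<exists>C \<subseteq> H. loose_cycle 3 l C"
proof -
  define s where "s i = Suc i mod l" for i
  define v where "v i = {2 * i, 2 * i + 1, 2 * s i}" for i
  define e where "e i = (!) p ` v i" for i
  have closed: "p ! (2 * l) = p ! 0"
    using assms(3) len by (metis add_diff_cancel_right' hd_conv_nth last_conv_nth length_0_conv
        add_is_0 zero_neq_one)
  have inj1: "x = y" if "p ! x = p ! y" "1 \<le> x" "1 \<le> y" "x \<le> 2 * l" "y \<le> 2 * l" for x y
  proof -
    have "tl p ! (x - 1) = tl p ! (y - 1)" using that len by (simp add: nth_tl)
    then have "x - 1 = y - 1" using dist that len by (subst (asm) nth_eq_iff_index_eq) auto
    then show ?thesis using that by simp
  qed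
  have inj: "inj_on ((!) p) {..<2 * l}"
  proof (rule inj_onI)
    fix x y assume xy: "x \<in> {..<2*l}" "y \<in> {..<2*l}" "p ! x = p ! y"
    show "x = y"
      using inj1[of x y] inj1[of "2 * l" y] inj1[of x "2 * l"] xy closed l
      by (cases "x = 0"; cases "y = 0") auto
  qed
  have s_less: "s i < l" for i using l by (simp add: s_def)
  have s_eq: "s i = (if Suc i = l then 0 else Suc i)" if "i < l" for i
    using that by (auto simp: s_def)
  have odd: "2 * a \<noteq> Suc (2 * b)" "Suc (2 * b) \<noteq> 2 * a" for a b :: nat by presburger+
  have v_sub: "v i \<subseteq> {..<2 * l}" if "i < l" for i
    using that s_less[of i] by (auto simp: v_def)
  have e_eq: "e i = {p ! (2 * i), p ! (2 * i + 1), p ! (2 * i + 2)}" if "i < l" for i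
    using that closed by (auto simp: e_def v_def s_eq)
  have e_int: "e i \<inter> e j = (!) p ` (v i \<inter> v j)" if "i < l" "j < l" for i j
    using inj_on_image_Int[OF inj v_sub[OF that(1)] v_sub[OF that(2)]] by (simp add: e_def)
  have card_e: "finite (e i) \<and> card (e i) = 3" if "i < l" for i
  proof -
    have "card (v i) = 3" using that l odd by (auto simp: v_def s_eq eval_nat_numeral)
    then show ?thesis using card_image[OF inj_on_subset[OF inj v_sub[OF that]]]
      by (simp add: e_def v_def)
  qed
  have v_succ: "v i \<inter> v (s i) = {2 * s i}" if "i < l" for i
    using that l odd s_less[of i] by (auto simp: v_def s_eq split: if_splits)
  have v_far: "v i \<inter> v j = {}" if "i < l" "j < l" "i \<noteq> j" "j \<noteq> s i" "i \<noteq> s j" for i j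
    using that l odd by (auto simp: v_def s_eq split: if_splits)
  have c: "card (e i \<inter> e (s i)) = 1" if "i < l" for i
    using e_int[OF that s_less] v_succ[OF that] by simp
  have inter: "if j = Suc i mod l \<or> i = Suc j mod l
              then card (e i \<inter> e j) = 1 else e i \<inter> e j = {}"
    if ij: "i < l" "j < l" "i \<noteq> j" for i j
    using c[OF ij(1)] c[OF ij(2)] e_int[OF ij(1,2)] v_far[OF ij] by (auto simp: s_def Int_commute)
  have inj_e: "inj_on e {..<l}"
  proof (rule inj_onI)
    fix i j assume ij: "i \<in> {..<l}" "j \<in> {..<l}" "e i = e j"
    show "i = j"
    proof (rule ccontr)
      assume "i \<noteq> j"
      then have "card (e i \<inter> e j) \<le> 1"
        using inter[of i j] ij by (auto split: if_splits)
      then show False using card_e[of i] ij by simp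
    qed
  qed
  have "v 0 \<inter> v 1 \<inter> v 2 = {}"
    using l by (auto simp: v_def s_eq split: if_splits)
  moreover have "e 0 \<inter> e 1 \<inter> e 2 = (!) p ` (v 0 \<inter> v 1 \<inter> v 2)"
  proof -
    have "v 0 \<inter> v 1 \<subseteq> {..<2 * l}" "v 2 \<subseteq> {..<2 * l}"
      using v_sub[of 0] v_sub[of 2] l by auto
    from inj_on_image_Int[OF inj this] show ?thesis
      using e_int[of 0 1] l by (simp add: e_def)
  qed
  moreover have "(\<Inter>i<l. e i) \<subseteq> e 0 \<inter> e 1 \<inter> e 2" using l by auto
  ultimately have "(\<Inter>i<l. e i) = {}" by blast
  then have "loose_cycle 3 l (e ` {..<l})"
    unfolding loose_cycle_def using inj_e card_e inter by blast
  moreover have "e ` {..<l} \<subseteq> H"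
    using p len e_eq by (auto simp: loose_path_def)
  ultimately show ?thesis by blast
qed

section \<open>Heavy and light pairs\<close>

text \<open>Distinct edges through \<open>{a, b}\<close> have distinct third vertices, so the
  vertices of \<open>Q\<close> cannot account for all of these edges.\<close>

lemma extend_heavy_pair:
  assumes H: "\<forall>e\<in>H. card e = 3" and "a \<noteq> b" and C: "card Q < card {e \<in> H. {a, b} \<subseteq> e}"
    and "finite Q"
  obtains x where "x \<notin> Q" "x \<noteq> a" "x \<noteq> b" "{a, b, x} \<in> H"
proof -
  have third: "\<exists>x. x \<noteq> a \<and> x \<noteq> b \<and> e = {a, b, x}" if "e \<in> H" "{a, b} \<subseteq> e" for e
  proof -
    have "card e = 3" using H that by auto
    moreover from this have "finite e" by (intro card_ge_0_finite) simp
    ultimately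
    have "card (e - {a, b}) = 1" using that \<open>a \<noteq> b\<close> by (subst card_Diff_subset) auto
    then obtain x where "e - {a, b} = {x}" by (auto simp: card_1_singleton_iff)
    then have "x \<noteq> a \<and> x \<noteq> b \<and> e = {a, b, x}" using that by blast
    then show ?thesis by blast
  qed
  have "\<not> {e \<in> H. {a, b} \<subseteq> e} \<subseteq> (\<lambda>x. {a, b, x}) ` Q"
    using C \<open>finite Q\<close> by (meson card_image_le card_mono finite_imageI le_trans not_le)
  then obtain e where e: "e \<in> H" "{a, b} \<subseteq> e" "e \<notin> (\<lambda>x. {a, b, x}) ` Q" by blast
  from third[OF e(1,2)] show ?thesis using e that by blast
qed

text \<open>Greedy growth that keeps both ends of the path inside one edge, so that the pair of ends
  stays heavy. After \<open>l - 1\<close> edges this pair yields the closing edge.\<close>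

lemma heavy_shadow_imp_loose_cycle:
  assumes H: "\<forall>e\<in>H. card e = 3" and "H \<noteq> {}" and l: "l \<ge> 3"
    and heavy: "\<And>e a b. e \<in> H \<Longrightarrow> a \<in> e \<Longrightarrow> b \<in> e \<Longrightarrow> a \<noteq> b \<Longrightarrow>
                  2 * l < card {e \<in> H. {a, b} \<subseteq> e}"
  shows "\<exists>C \<subseteq> H. loose_cycle 3 l C"
proof -
  have ext: "\<exists>x. x \<notin> Q \<and> x \<noteq> a \<and> x \<noteq> b \<and> {a, b, x} \<in> H"
    if "{a, b} \<subseteq> e" "e \<in> H" "a \<noteq> b" "finite Q" "card Q \<le> 2 * l" for a b e Q
    using extend_heavy_pair[OF H that(3) _ that(4)] heavy[OF that(2), of a b] that
    by (metis insert_subset le_less_trans)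
  have "\<exists>p e. loose_path H p \<and> distinct p \<and> length p = 2 * m + 1 \<and> e \<in> H \<and>
          {hd p, last p} \<subseteq> e" if "1 \<le> m" "m < l" for m
    using that
  proof (induction m rule: dec_induct)
    case base
    obtain e where e: "e \<in> H" using \<open>H \<noteq> {}\<close> by blast
    then obtain a b c where abc: "e = {a, b, c}" "a \<noteq> b" "a \<noteq> c" "b \<noteq> c"
      using H by (metis card_3_iff)
    have "loose_path H [a, b, c]" using e abc loose_path_edge by metis
    then show ?case using abc e by (intro exI[of _ "[a, b, c]"] exI[of _ e]) auto
  next
    case (step m)
    then obtain p e where p: "loose_path H p" "distinct p" "length p = 2 * m + 1" "e \<in> H"
      "{hd p, last p} \<subseteq> e" by auto
    have ne: "hd p \<noteq> last p"
      using p step(1) by (cases p) (auto simp: last_in_set)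
    have cp: "card (set p) = 2 * m + 1" using p distinct_card by metis
    \<comment> \<open>The edge \<open>{hd p, last p, x}\<close> is not put on the path: it makes
      \<open>{last p, x}\<close> heavy, and it contains the new pair of ends \<open>hd p\<close> and
      \<open>x\<close>.\<close>
    obtain x where x: "x \<notin> set p" "x \<noteq> hd p" "x \<noteq> last p" "{hd p, last p, x} \<in> H"
      using ext[OF p(5,4) ne, of "set p"] cp step.prems by auto
    obtain w where w: "w \<notin> set p" "w \<noteq> last p" "w \<noteq> x" "{last p, x, w} \<in> H"
      using ext[of "last p" x "{hd p, last p, x}" "set p"] x cp step.prems by auto
    have "loose_path H (p @ [w, x])"
      using loose_path_snoc[OF p(1) refl, of w x] w(4) by (simp add: insert_commute)
    then show ?case
      using p x w
      by (intro exI[of _ "p @ [w, x]"] exI[of _ "{hd p, last p, x}"]) (auto simp: hd_append)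
  qed
  moreover have "1 \<le> l - 1" "l - 1 < l" using l by auto
  ultimately obtain p e where
    p: "loose_path H p" "distinct p" "length p = 2 * (l - 1) + 1" "e \<in> H" "{hd p, last p} \<subseteq> e"
    by blast
  have pe: "p = hd p # tl p" "tl p \<noteq> []" using p(3) l by (auto intro!: hd_Cons_tl[symmetric] simp: tl_Nil)
  have ne: "hd p \<noteq> last p"
    using pe p(2) by (metis distinct.simps(2) last_ConsR last_in_set)
  have cp: "card (set p) = 2 * (l - 1) + 1" using p distinct_card by metis
  obtain w where w: "w \<notin> set p" "{hd p, last p, w} \<in> H"
    using ext[OF p(5,4) ne finite_set, of p] cp l by fastforce
  have "loose_path H (p @ [w, hd p])"
    using loose_path_snoc[OF p(1) refl, of w "hd p"] w(2) by (simp add: insert_commute)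
  moreover have "distinct (tl (p @ [w, hd p]))"
    using p(2) w(1) by (cases p) auto
  moreover have "length (p @ [w, hd p]) = 2 * l + 1" using p(3) l by simp
  moreover have "hd (p @ [w, hd p]) = last (p @ [w, hd p])" using pe by (cases p) auto
  ultimately show ?thesis using closed_loose_path_imp_loose_cycle l by blast
qed

text \<open>
  Remove edges one by one, each time one that contains a pair of codegree below \<open>C\<close> in what is left
  (such an edge exists, as otherwise there is a loose cycle), and let \<open>L e\<close> consist of the pairs of
  small codegree at the time \<open>e\<close> is removed.
\<close>

lemma light_pair_assignment:
  assumes "finite H" "\<forall>e\<in>H. card e = 3" "l \<ge> 3" "2 * l < C"
    and "\<not> (\<exists>Z \<subseteq> H. loose_cycle 3 l Z)"
  shows "\<exists>L :: 'a set \<Rightarrow> 'a set set.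
     (\<forall>e\<in>H. \<exists>a\<in>e. \<exists>b\<in>e. a \<noteq> b \<and> {a, b} \<in> L e) \<and>
     (\<forall>Q. card {e \<in> H. Q \<subseteq> e \<and> Q \<in> L e} < C) \<and>
     (\<forall>e\<in>H. \<forall>Q. Q \<notin> L e \<longrightarrow> C \<le> card {e \<in> H. Q \<subseteq> e})"
  using assms
proof (induction "card H" arbitrary: H rule: less_induct)
  case less
  show ?case
  proof (cases "H = {}")
    case True
    then show ?thesis using less.prems by auto
  next
    case False
    obtain e a b where e: "e \<in> H" "a \<in> e" "b \<in> e" "a \<noteq> b" and
      "\<not> 2 * l < card {e \<in> H. {a, b} \<subseteq> e}"
      using heavy_shadow_imp_loose_cycle[OF less.prems(2) False less.prems(3)] less.prems(5)
      by blast
    then have light: "card {e \<in> H. {a, b} \<subseteq> e} < C" using less.prems(4) by simp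
    define H' where "H' = H - {e}"
    have "card H' < card H" unfolding H'_def using e(1) less.prems(1) by (rule card_Diff1_less[rotated])
    moreover have "\<not> (\<exists>Z \<subseteq> H'. loose_cycle 3 l Z)" using less.prems(5) by (auto simp: H'_def)
    ultimately obtain L' where L':
      "\<forall>e\<in>H'. \<exists>a\<in>e. \<exists>b\<in>e. a \<noteq> b \<and> {a, b} \<in> L' e"
      "\<forall>Q. card {e \<in> H'. Q \<subseteq> e \<and> Q \<in> L' e} < C"
      "\<forall>e\<in>H'. \<forall>Q. Q \<notin> L' e \<longrightarrow> C \<le> card {e \<in> H'. Q \<subseteq> e}"
      using less.hyps[of H'] less.prems by (auto simp: H'_def)
    define L where "L = L'(e := {Q. card {e' \<in> H. Q \<subseteq> e'} < C})"
    have "\<exists>a\<in>f. \<exists>b\<in>f. a \<noteq> b \<and> {a, b} \<in> L f" if "f \<in> H" for f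
      using that L'(1) e light by (cases "f = e") (auto simp: L_def H'_def)
    moreover have "card {f \<in> H. Q \<subseteq> f \<and> Q \<in> L f} < C" for Q
    proof (cases "card {f \<in> H. Q \<subseteq> f} < C")
      case True
      moreover have "card {f \<in> H. Q \<subseteq> f \<and> Q \<in> L f} \<le> card {f \<in> H. Q \<subseteq> f}"
        using less.prems(1) by (intro card_mono) auto
      ultimately show ?thesis by simp
    next
      case False
      \<comment> \<open>Here \<open>Q \<notin> L e\<close>, so the edge \<open>e\<close> contributes
        nothing and the bound for \<open>H'\<close> carries over.\<close>
      then have "{f \<in> H. Q \<subseteq> f \<and> Q \<in> L f} = {f \<in> H'. Q \<subseteq> f \<and> Q \<in> L' f}"
        by (auto simp: L_def H'_def)
      then show ?thesis using L'(2) by simp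
    qed
    moreover have "C \<le> card {f \<in> H. Q \<subseteq> f}" if "f \<in> H" "Q \<notin> L f" for f Q
    proof (cases "f = e")
      case True
      then show ?thesis using that by (simp add: L_def)
    next
      case False
      then have "C \<le> card {f \<in> H'. Q \<subseteq> f}" using that L'(3) by (simp add: L_def H'_def)
      also have "\<dots> \<le> card {f \<in> H. Q \<subseteq> f}"
        using less.prems(1) by (intro card_mono) (auto simp: H'_def)
      finally show ?thesis .
    qed
    ultimately show ?thesis by blast
  qed
qed

section \<open>Independent sets in sparse hypergraphs\<close>

lemma fibre_pigeonhole:
  assumes "finite A" "finite B" "f ` A \<subseteq> B" "A \<noteq> {}"
  shows "\<exists>b\<in>B. card A \<le> card B * card {a \<in> A. f a = b}"
proof (rule ccontr)
  assume neg: "\<not> ?thesis"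
  have "B \<noteq> {}" using assms by auto
  have "card A = (\<Sum>b\<in>B. card {a \<in> A. f a = b})"
    using sum.group[OF assms(1,2,3), of "\<lambda>_. 1 :: nat"] by (simp only: card_eq_sum)
  then have "card B * card A = (\<Sum>b\<in>B. card B * card {a \<in> A. f a = b})"
    by (simp add: sum_distrib_left)
  also have "\<dots> < (\<Sum>b\<in>B. card A)"
    using neg \<open>B \<noteq> {}\<close> assms(2) by (intro sum_strict_mono) (auto simp: not_le)
  finally show False by simp
qed

text \<open>First-moment argument with \<open>q\<close> colours,
  \<open>2 * \<tau> \<le> q \<le> 3 * \<tau>\<close>. Some colouring has at most
  \<open>card H / q\<^sup>2\<close>, hence at most a quarter of \<open>card W\<close>, monochromatic
  edges. Deleting a vertex from each leaves three quarters of \<open>W\<close>, and a largest colour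
  class of the rest is independent.\<close>

lemma sparse_imp_large_independent:
  fixes \<tau> :: real
  assumes W: "finite W" and HW: "\<forall>e\<in>H. e \<subseteq> W" and H3: "\<forall>e\<in>H. card e = 3" and "\<tau> \<ge> 1"
    and sparse: "real (card H) \<le> real (card W) * \<tau>\<^sup>2"
  shows "\<exists>I \<subseteq> W. (\<forall>e\<in>H. \<not> e \<subseteq> I) \<and> real (card W) \<le> 4 * \<tau> * real (card I)"
proof -
  define q where "q = nat \<lceil>2 * \<tau>\<rceil>"
  have q: "2 * \<tau> \<le> real q" "real q \<le> 3 * \<tau>" "q > 0"
    using \<open>\<tau> \<ge> 1\<close> unfolding q_def by linarith+
  have finH: "finite H" using W HW by (intro finite_subset[of H "Pow W"]) auto
  define m where "m = card W"
  define F where "F = W \<rightarrow>\<^sub>E {..<q}"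
  have finF: "finite F" and cardF: "card F = q ^ m"
    unfolding F_def m_def using W by (auto intro: finite_PiE simp: card_PiE)
  define mono where "mono \<chi> = {e \<in> H. \<forall>x\<in>e. \<forall>y\<in>e. \<chi> x = \<chi> y}" for \<chi> :: "'a \<Rightarrow> nat"
  have one: "card {\<chi> \<in> F. e \<in> mono \<chi>} * q\<^sup>2 \<le> q ^ m" if eH: "e \<in> H" for e
  proof -
    obtain a b c where abc: "e = {a, b, c}" "a \<noteq> b" "a \<noteq> c" "b \<noteq> c"
      using H3 eH by (metis card_3_iff)
    have sub: "{b, c} \<subseteq> W" and a: "a \<in> W - {b, c}" using HW eH abc by auto
    \<comment> \<open>If \<open>e\<close> is monochromatic, the colour of \<open>a\<close>
      determines those of \<open>b\<close> and \<open>c\<close>, so forgetting the latter two is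
      injective.\<close>
    define r where "r \<chi> = restrict \<chi> (W - {b, c})" for \<chi> :: "'a \<Rightarrow> nat"
    have "inj_on r {\<chi> \<in> F. e \<in> mono \<chi>}"
    proof (rule inj_onI)
      fix \<chi> \<psi> assume \<chi>: "\<chi> \<in> {\<chi> \<in> F. e \<in> mono \<chi>}" and \<psi>: "\<psi> \<in> {\<chi> \<in> F. e \<in> mono \<chi>}"
        and eq: "r \<chi> = r \<psi>"
      have away: "\<chi> x = \<psi> x" if "x \<in> W - {b, c}" for x
        using fun_cong[OF eq, of x] that unfolding r_def by simp
      have "a \<in> e" "b \<in> e" "c \<in> e" using abc by auto
      moreover have "\<forall>x\<in>e. \<forall>y\<in>e. \<chi> x = \<chi> y" "\<forall>x\<in>e. \<forall>y\<in>e. \<psi> x = \<psi> y"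
        using \<chi> \<psi> unfolding mono_def by blast+
      ultimately have "\<chi> b = \<chi> a" "\<chi> c = \<chi> a" "\<psi> b = \<psi> a" "\<psi> c = \<psi> a" by blast+
      then have "\<chi> x = \<psi> x" if "x \<in> W" for x using away[OF a] away[of x] that by (cases "x = b \<or> x = c") auto
      then show "\<chi> = \<psi>"
        using \<chi> \<psi> by (intro PiE_ext[of \<chi> W "\<lambda>_. {..<q}"]) (auto simp: F_def)
    qed
    moreover have "r ` {\<chi> \<in> F. e \<in> mono \<chi>} \<subseteq> (W - {b, c}) \<rightarrow>\<^sub>E {..<q}"
      unfolding r_def F_def by (auto simp: restrict_PiE_iff PiE_iff split: if_splits)
    ultimately have "card {\<chi> \<in> F. e \<in> mono \<chi>} \<le> card ((W - {b, c}) \<rightarrow>\<^sub>E {..<q})"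
      using W by (intro card_inj_on_le) (auto intro: finite_PiE)
    also have "\<dots> = q ^ (m - 2)"
      using W sub abc by (simp add: card_PiE m_def card_Diff_subset numeral_2_eq_2)
    finally have "card {\<chi> \<in> F. e \<in> mono \<chi>} * q\<^sup>2 \<le> q ^ (m - 2) * q\<^sup>2" by simp
    also have "\<dots> = q ^ m"
    proof -
      have "2 \<le> m" using card_mono[OF W sub] abc by (simp add: m_def)
      then show ?thesis by (metis le_add_diff_inverse2 power_add)
    qed
    finally show ?thesis .
  qed
  \<comment> \<open>Averaging over all colourings, by counting pairs of a colouring and a
    monochromatic edge in two ways.\<close>
  have "\<exists>\<chi>\<in>F. card (mono \<chi>) * q\<^sup>2 \<le> card H"
  proof (rule ccontr)
    assume "\<not> ?thesis"
    then have neg: "\<And>\<chi>. \<chi> \<in> F \<Longrightarrow> card H < card (mono \<chi>) * q\<^sup>2" by force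
    have "F \<noteq> {}" using cardF q by (metis card.empty power_not_zero not_gr_zero)
    have cm: "card (mono \<chi>) = (\<Sum>e\<in>H. if e \<in> mono \<chi> then 1 else 0)" for \<chi>
    proof -
      have "mono \<chi> = {e \<in> H. e \<in> mono \<chi>}" by (auto simp: mono_def)
      then show ?thesis using finH by (simp add: sum.If_cases Int_def)
    qed
    have "card F * card H = (\<Sum>\<chi>\<in>F. card H)" by simp
    also have "\<dots> < (\<Sum>\<chi>\<in>F. card (mono \<chi>) * q\<^sup>2)"
      using neg finF \<open>F \<noteq> {}\<close> by (intro sum_strict_mono) auto
    also have "\<dots> = (\<Sum>\<chi>\<in>F. \<Sum>e\<in>H. if e \<in> mono \<chi> then 1 else 0) * q\<^sup>2"
      by (simp add: cm sum_distrib_right)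
    also have "\<dots> = (\<Sum>e\<in>H. card {\<chi> \<in> F. e \<in> mono \<chi>} * q\<^sup>2)"
      using finF by (subst sum.swap) (simp add: sum.If_cases Int_def sum_distrib_right)
    also have "\<dots> \<le> (\<Sum>e\<in>H. q ^ m)" by (intro sum_mono one)
    finally show False by (simp add: cardF mult.commute)
  qed
  then obtain \<chi> where \<chi>: "\<chi> \<in> F" "card (mono \<chi>) * q\<^sup>2 \<le> card H" by blast
  have mono_small: "4 * real (card (mono \<chi>)) \<le> real m"
  proof -
    have "real (card (mono \<chi>)) * (2 * \<tau>)\<^sup>2 \<le> real (card (mono \<chi>)) * (real q)\<^sup>2"
      using q \<open>\<tau> \<ge> 1\<close> by (intro mult_left_mono power_mono) auto
    also have "\<dots> = real (card (mono \<chi>) * q\<^sup>2)" by simp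
    also have "\<dots> \<le> real (card H)" using \<chi>(2) by (rule of_nat_mono)
    also have "\<dots> \<le> real m * \<tau>\<^sup>2" using sparse by (simp add: m_def)
    finally have "(4 * real (card (mono \<chi>))) * \<tau>\<^sup>2 \<le> real m * \<tau>\<^sup>2"
      by (simp add: power_mult_distrib)
    moreover have "\<tau>\<^sup>2 > 0" using \<open>\<tau> \<ge> 1\<close> by simp
    ultimately show ?thesis by (simp only: mult_le_cancel_right_pos)
  qed
  have nonempty: "e \<noteq> {}" if "e \<in> H" for e using H3 that by force
  then have "\<exists>t. \<forall>e\<in>mono \<chi>. t e \<in> e"
    by (intro bchoice) (metis (no_types, lifting) all_not_in_conv mem_Collect_eq mono_def)
  then obtain t where t: "\<forall>e\<in>mono \<chi>. t e \<in> e" by blast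
  have fmono: "finite (mono \<chi>)" using finH by (simp add: mono_def)
  define W' where "W' = W - t ` mono \<chi>"
  have W': "finite W'" "W' \<subseteq> W" using W by (auto simp: W'_def)
  have "card W \<le> card W' + card (mono \<chi>)"
  proof -
    have "card W \<le> card (W' \<union> t ` mono \<chi>)"
      using W fmono by (intro card_mono) (auto simp: W'_def)
    also have "\<dots> \<le> card W' + card (t ` mono \<chi>)" by (rule card_Un_le)
    also have "\<dots> \<le> card W' + card (mono \<chi>)" using card_image_le[OF fmono] by simp
    finally show ?thesis .
  qed
  with mono_small have cW': "3 * real m \<le> 4 * real (card W')" by (simp add: m_def)
  show ?thesis
  proof (cases "W' = {}")
    case True
    then have "card W = 0" using cW' by (simp add: m_def)
    then show ?thesis using nonempty by (intro exI[of _ "{}"]) auto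
  next
    case False
    have "\<chi> ` W' \<subseteq> {..<q}" using \<chi>(1) W' by (auto simp: F_def)
    then obtain j where "card W' \<le> card {..<q} * card {x \<in> W'. \<chi> x = j}"
      using fibre_pigeonhole[OF W'(1) _ _ False, of "{..<q}" \<chi>] by auto
    then have j: "real (card W') \<le> real q * real (card {x \<in> W'. \<chi> x = j})"
      by (metis card_lessThan of_nat_le_iff of_nat_mult)
    define I where "I = {x \<in> W'. \<chi> x = j}"
    have "\<not> e \<subseteq> I" if "e \<in> H" for e
    proof
      assume "e \<subseteq> I"
      then have "e \<in> mono \<chi>" using that by (auto simp: mono_def I_def)
      then have "t e \<in> e" "t e \<notin> W'" using t by (auto simp: W'_def)
      then show False using \<open>e \<subseteq> I\<close> by (auto simp: I_def)
    qed
    moreover have "real (card W) \<le> 4 * \<tau> * real (card I)"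
    proof -
      have "3 * real m \<le> 4 * (real q * real (card I))" using cW' j by (simp add: I_def)
      also have "\<dots> \<le> 4 * (3 * \<tau> * real (card I))"
        using q by (intro mult_left_mono mult_right_mono) auto
      finally show ?thesis by (simp add: m_def)
    qed
    ultimately show ?thesis using W' by (intro exI[of _ I]) (auto simp: I_def)
  qed
qed

section \<open>Linked levels\<close>

text \<open>
  \<open>X\<close> models the \<open>i\<close>-th level of a breadth-first tree and \<open>P\<close> the other vertices used by that tree;
  \<open>\<rho>\<close> is the left-to-right order of the level, and \<open>d a b\<close> the height of the lowest common ancestor of
  \<open>a\<close> and \<open>b\<close> above the level. The tree itself is forgotten: all that matters is that
  \<open>a\<close> and \<open>b\<close> are joined by a loose path with \<open>2 * d a b\<close> edges (hence \<open>4 * d a b + 1\<close> vertices) that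
  can avoid any small set \<open>Q\<close> outside \<open>P\<close>.
\<close>

definition linked ::
  "'a set set \<Rightarrow> nat \<Rightarrow> nat \<Rightarrow> 'a set \<Rightarrow> 'a set \<Rightarrow> ('a \<Rightarrow> nat) \<Rightarrow> ('a \<Rightarrow> 'a \<Rightarrow> nat) \<Rightarrow> bool" where
  "linked H K i X P \<rho> d \<longleftrightarrow> X \<inter> P = {} \<and> inj_on \<rho> X \<and>
     (\<forall>a\<in>X. \<forall>b\<in>X. \<rho> a < \<rho> b \<longrightarrow> 1 \<le> d a b \<and> d a b \<le> i \<and>
        (\<forall>Q. finite Q \<and> card Q \<le> K \<and> Q \<inter> P = {} \<and> a \<notin> Q \<and> b \<notin> Q \<longrightarrow>
          (\<exists>p. loose_path H p \<and> distinct p \<and> hd p = a \<and> last p = b \<and>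
               length p = 4 * d a b + 1 \<and> set p \<inter> Q = {}))) \<and>
     (\<forall>a\<in>X. \<forall>b\<in>X. \<forall>c\<in>X. \<rho> a < \<rho> b \<longrightarrow> \<rho> b < \<rho> c \<longrightarrow> d a c = max (d a b) (d b c))"

lemma linkedD:
  assumes "linked H K i X P \<rho> d"
  shows "X \<inter> P = {}" "inj_on \<rho> X"
    "\<And>a b. a \<in> X \<Longrightarrow> b \<in> X \<Longrightarrow> \<rho> a < \<rho> b \<Longrightarrow> 1 \<le> d a b \<and> d a b \<le> i"
    "\<And>a b Q. a \<in> X \<Longrightarrow> b \<in> X \<Longrightarrow> \<rho> a < \<rho> b \<Longrightarrow> finite Q \<Longrightarrow> card Q \<le> K \<Longrightarrow> Q \<inter> P = {} \<Longrightarrow>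
       a \<notin> Q \<Longrightarrow> b \<notin> Q \<Longrightarrow> \<exists>p. loose_path H p \<and> distinct p \<and> hd p = a \<and> last p = b \<and>
               length p = 4 * d a b + 1 \<and> set p \<inter> Q = {}"
    "\<And>a b c. a \<in> X \<Longrightarrow> b \<in> X \<Longrightarrow> c \<in> X \<Longrightarrow> \<rho> a < \<rho> b \<Longrightarrow> \<rho> b < \<rho> c \<Longrightarrow>
       d a c = max (d a b) (d b c)"
proof -
  note lk = assms[unfolded linked_def]
  show "X \<inter> P = {}" using lk by (rule conjunct1)
  show "inj_on \<rho> X" using lk by (elim conjE)
  note lk = lk[THEN conjunct2, THEN conjunct2]
  note dist = lk[THEN conjunct1, rule_format] and ultra = lk[THEN conjunct2, rule_format]
  show "1 \<le> d a b \<and> d a b \<le> i" if "a \<in> X" "b \<in> X" "\<rho> a < \<rho> b" for a b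
    using dist[OF that] by blast
  show "\<exists>p. loose_path H p \<and> distinct p \<and> hd p = a \<and> last p = b \<and>
               length p = 4 * d a b + 1 \<and> set p \<inter> Q = {}"
    if ab: "a \<in> X" "b \<in> X" "\<rho> a < \<rho> b" and Q: "finite Q" "card Q \<le> K" "Q \<inter> P = {}" "a \<notin> Q" "b \<notin> Q"
    for a b Q
    using dist[OF ab, THEN conjunct2, THEN conjunct2, THEN spec[of _ Q]] Q by simp
  show "d a c = max (d a b) (d b c)"
    if "a \<in> X" "b \<in> X" "c \<in> X" "\<rho> a < \<rho> b" "\<rho> b < \<rho> c" for a b c
    using ultra[OF that] .
qed

section \<open>Closing increasing paths inside a level\<close>

text \<open>By the ultrametric rule \<open>g 0 m\<close> is attained at some single step from
  \<open>q\<close> to \<open>Suc q\<close>, and every window containing that step has the same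
  value. It remains to take such a window of length \<open>l - 2 * g 0 m\<close>.\<close>

lemma ultrametric_segment:
  fixes g :: "nat \<Rightarrow> nat \<Rightarrow> nat"
  assumes ultra: "\<And>a b c. a < b \<Longrightarrow> b < c \<Longrightarrow> c \<le> m \<Longrightarrow> g a c = max (g a b) (g b c)"
    and bound: "\<And>a b. a < b \<Longrightarrow> b \<le> m \<Longrightarrow> 1 \<le> g a b \<and> 2 * g a b < l"
    and "l \<le> m" "1 \<le> m"
  shows "\<exists>s e. s < e \<and> e \<le> m \<and> e - s + 2 * g s e = l"
proof -
  have "\<exists>q<e. g 0 e = g q (Suc q)" if "1 \<le> e" "e \<le> m" for e
    using that
  proof (induction e rule: dec_induct)
    case base
    show ?case by auto
  next
    case (step e)
    then obtain q where "q < e" "g 0 e = g q (Suc q)" by auto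
    moreover have "g 0 (Suc e) = max (g 0 e) (g e (Suc e))" using step by (intro ultra) auto
    ultimately show ?case by (metis less_Suc_eq max_def)
  qed
  then obtain q where q: "q < m" "g 0 m = g q (Suc q)" using \<open>1 \<le> m\<close> by blast
  define L where "L = l - 2 * g 0 m"
  \<comment> \<open>The window starts at \<open>q\<close> unless it would run past \<open>m\<close>,
    in which case it is shifted back to end at \<open>m\<close>; both choices contain the step at
    \<open>q\<close>.\<close>
  define s where "s = (if q + L \<le> m then q else m - L)"
  have L: "1 \<le> L" "L \<le> m" "L + 2 * g 0 m = l"
    using bound[of 0 m] \<open>l \<le> m\<close> \<open>1 \<le> m\<close> by (auto simp: L_def)
  have s: "s \<le> q" "q < s + L" "s + L \<le> m" using L q by (auto simp: s_def)
  have "g q (Suc q) \<le> g s (s + L)"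
  proof -
    have "g q (Suc q) \<le> g q (s + L)"
      using ultra[of q "Suc q" "s + L"] s by (cases "Suc q = s + L") auto
    also have "\<dots> \<le> g s (s + L)"
      using ultra[of s q "s + L"] s by (cases "s = q") auto
    finally show ?thesis .
  qed
  moreover have "g s (s + L) \<le> g 0 m"
  proof -
    have "g s (s + L) \<le> g 0 (s + L)"
      using ultra[of 0 s "s + L"] s L by (cases "s = 0") auto
    also have "\<dots> \<le> g 0 m"
      using ultra[of 0 "s + L" m] s L by (cases "s + L = m") auto
    finally show ?thesis .
  qed
  ultimately have "g s (s + L) = g 0 m" using q by simp
  then show ?thesis using L s by (intro exI[of _ s] exI[of _ "s + L"]) simp
qed

text \<open>A window of the path with \<open>L\<close> edges and a link between its ends with
  \<open>2 * d\<close> edges close up to a cycle. \<open>ultrametric_segment\<close> finds a window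
  for which the total is exactly \<open>l\<close>; \<open>2 * i < l\<close> keeps every link shorter
  than \<open>l\<close>.\<close>

lemma linked_monotone_path_imp_loose_cycle:
  assumes lk: "linked H K i X P \<rho> d" and "2 * i < l" "2 * l \<le> K" "3 \<le> l"
    and p: "loose_path H p" "distinct p" "set p \<inter> P = {}"
    and X: "\<And>j. 2 * j < length p \<Longrightarrow> p ! (2 * j) \<in> X"
    and mono: "\<And>j. 2 * j + 2 < length p \<Longrightarrow> \<rho> (p ! (2 * j)) < \<rho> (p ! (2 * j + 2))"
    and len: "length p = 2 * m + 1" "l \<le> m"
  shows "\<exists>C \<subseteq> H. loose_cycle 3 l C"
proof -
  define x where "x j = p ! (2 * j)" for j
  have xX: "x j \<in> X" if "j \<le> m" for j using X[of j] that len by (simp add: x_def)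
  have less: "\<rho> (x a) < \<rho> (x b)" if "a < b" "b \<le> m" for a b
    using that
  proof (induction a b rule: less_Suc_induct)
    case (1 a)
    then show ?case using mono[of a] len by (simp add: x_def)
  next
    case (2 a b c)
    then show ?case by simp
  qed
  have "\<exists>s e. s < e \<and> e \<le> m \<and> e - s + 2 * d (x s) (x e) = l"
  proof (rule ultrametric_segment)
    fix a b assume ab: "a < b" "b \<le> m"
    have "1 \<le> d (x a) (x b) \<and> d (x a) (x b) \<le> i"
      using ab by (intro linkedD(3)[OF lk] xX less) auto
    then show "1 \<le> d (x a) (x b) \<and> 2 * d (x a) (x b) < l" using \<open>2 * i < l\<close> by linarith
  qed (use linkedD(5)[OF lk] xX less len \<open>3 \<le> l\<close> in auto)
  then obtain s e where se: "s < e" "e \<le> m" "e - s + 2 * d (x s) (x e) = l" by blast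
  define L where "L = e - s"
  have L: "e = s + L" "1 \<le> L" "L \<le> l" using se by (auto simp: L_def)
  define u where "u = take (2 * L + 1) (drop (2 * s) p)"
  have u: "loose_path H u"
    unfolding u_def using p(1) se L len by (intro loose_path_segment) auto
  have ulen: "length u = 2 * L + 1" using se L len by (simp add: u_def)
  have u_nth: "u ! j = p ! (2 * s + j)" if "j \<le> 2 * L" for j
    using that se L len by (simp add: u_def)
  have ne: "u \<noteq> []" using ulen by auto
  have hu: "hd u = x s" using u_nth[of 0] ne by (simp add: hd_conv_nth x_def)
  have lu: "last u = x e" using u_nth[of "2 * L"] ne ulen L by (simp add: last_conv_nth x_def algebra_simps)
  have du: "distinct u" and su: "set u \<subseteq> set p"
    unfolding u_def using p(2) by (auto dest: in_set_takeD in_set_dropD)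
  have xse: "x s \<in> X" "x e \<in> X" using xX se by auto
  \<comment> \<open>The link has to miss the interior of the window. This is an admissible set to
    avoid because \<open>p\<close> is disjoint from \<open>P\<close> and \<open>Q\<close> has at
    most \<open>2 * l\<close> elements.\<close>
  define Q where "Q = set u - {x s, x e}"
  have "card Q \<le> K"
  proof -
    have "x s \<in> set u" using hd_in_set[OF ne] hu by simp
    then have "Q \<subset> set u" unfolding Q_def by blast
    then have "card Q < card (set u)" by (intro psubset_card_mono) simp_all
    also have "\<dots> \<le> 2 * L + 1" using ulen card_length[of u] by simp
    finally show ?thesis using L \<open>2 * l \<le> K\<close> by simp
  qed
  moreover have "finite Q" "Q \<inter> P = {}" "x s \<notin> Q" "x e \<notin> Q" using su p(3) by (auto simp: Q_def)
  ultimately obtain v where v: "loose_path H v" "distinct v" "hd v = x s" "last v = x e"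
    "length v = 4 * d (x s) (x e) + 1" "set v \<inter> Q = {}"
    using linkedD(4)[OF lk xse less[OF se(1,2)], of Q] by auto
  have dpos: "1 \<le> d (x s) (x e)"
    using linkedD(3)[OF lk xse less[OF se(1,2)]] by simp
  define c where "c = u @ tl (rev v)"
  have "loose_path H c"
    unfolding c_def using u loose_path_rev[OF v(1)] lu v(4) loose_path_nonempty[OF v(1)]
    by (intro loose_path_join) (auto simp: hd_rev)
  moreover have "length c = 2 * l + 1"
    using ulen v(5) se(3) by (simp add: c_def L_def)
  moreover have tlne: "tl (rev v) \<noteq> []"
  proof -
    have "length (tl (rev v)) > 0" using v(5) dpos by simp
    then show ?thesis by blast
  qed
  have "hd c = last c"
    using ne tlne hu v(3) by (simp add: c_def last_tl last_rev)
  moreover have "distinct (tl c)"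
  proof -
    have "tl c = tl u @ tl (rev v)" using ne by (simp add: c_def)
    moreover have "x s \<notin> set (tl u)" using du hu ne by (cases u) auto
    moreover have "x e \<notin> set (tl (rev v))"
      using v(2,4) by (cases v rule: rev_cases) auto
    moreover have "set (tl u) \<subseteq> set u" using ne by (cases u) auto
    moreover have "set (tl (rev v)) \<subseteq> set v" by (cases v rule: rev_cases) auto
    ultimately have "set (tl u) \<inter> set (tl (rev v)) = {}"
      using v(6) unfolding Q_def by blast
    then show ?thesis using \<open>tl c = _\<close> du v(2) by (simp add: distinct_tl)
  qed
  ultimately show ?thesis using closed_loose_path_imp_loose_cycle \<open>3 \<le> l\<close> by blast
qed

text \<open>
  Colour \<open>x\<close> by the length of the longest increasing loose path ending at \<open>x\<close>; a path with \<open>l\<close> edges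
  would close up to an \<open>l\<close>-cycle. An edge with two vertices in one colour class cannot prolong the
  path chosen at its smaller vertex, so its third vertex lies on that path, in \<open>P\<close>, or in the rest
  of the level.
\<close>

lemma linked_level_sparse_subset:
  assumes lk: "linked H K i X P \<rho> d" and l: "2 * i < l" "2 * l \<le> K" "3 \<le> l"
    and X: "finite X" and H3: "\<forall>e\<in>H. card e = 3"
    and free: "\<not> (\<exists>C \<subseteq> H. loose_cycle 3 l C)"
  shows "\<exists>I S. I \<subseteq> X \<and> finite S \<and> S \<inter> X = {} \<and> card S \<le> 2 * l * card X \<and>
           card X \<le> l * card I \<and> (\<forall>e\<in>H. e \<inter> (S \<union> P \<union> (X - I)) = {} \<longrightarrow> card (e \<inter> I) \<le> 1)"
proof (cases "X = {}")
  case True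
  then show ?thesis by (intro exI[of _ "{}"]) auto
next
  case False
  \<comment> \<open>The last conjunct also covers inner vertices lying in the level; it ensures that
    a level vertex above \<open>last p\<close> is not yet on the path.\<close>
  define mon where "mon p \<longleftrightarrow> loose_path H p \<and> distinct p \<and> set p \<inter> P = {} \<and>
    (\<forall>j. 2 * j < length p \<longrightarrow> p ! (2 * j) \<in> X) \<and>
    (\<forall>j. 2 * j + 2 < length p \<longrightarrow> \<rho> (p ! (2 * j)) < \<rho> (p ! (2 * j + 2))) \<and>
    (\<forall>w\<in>set p \<inter> X. \<rho> w \<le> \<rho> (last p))" for p
  define A where "A x = {m. \<exists>p. mon p \<and> last p = x \<and> length p = 2 * m + 1}" for x
  have A_bound: "m < l" if mA: "m \<in> A x" for m x
  proof (rule ccontr)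
    assume "\<not> m < l"
    moreover obtain p where "mon p" "length p = 2 * m + 1" using mA by (auto simp: A_def)
    ultimately show False
      using linked_monotone_path_imp_loose_cycle[OF lk l, of p m] free by (auto simp: mon_def)
  qed
  have A_fin: "finite (A x)" for x
    using A_bound by (intro finite_subset[of "A x" "{..<l}"]) auto
  have A_ne: "0 \<in> A x" if "x \<in> X" for x
    unfolding A_def mon_def using that linkedD(1)[OF lk]
    by (auto simp: loose_path_singleton intro!: exI[of _ "[x]"])
  define f where "f x = Max (A x)" for x
  have fA: "f x \<in> A x" if "x \<in> X" for x
    unfolding f_def using A_fin A_ne[OF that] by (intro Max_in) auto
  have f_ge: "m \<le> f x" if "m \<in> A x" for m x
    unfolding f_def using A_fin that by (rule Max_ge)
  have "\<forall>x\<in>X. \<exists>p. mon p \<and> last p = x \<and> length p = 2 * f x + 1"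
    using fA by (auto simp: A_def)
  then obtain pp where pp: "\<And>x. x \<in> X \<Longrightarrow> mon (pp x) \<and> last (pp x) = x \<and> length (pp x) = 2 * f x + 1"
    by metis
  have "f ` X \<subseteq> {..<l}" using A_bound fA by auto
  then obtain j where j: "card X \<le> l * card {x \<in> X. f x = j}"
    using fibre_pigeonhole[OF X _ _ False, of "{..<l}" f] by auto
  define I where "I = {x \<in> X. f x = j}"
  \<comment> \<open>A vertex outside both \<open>S\<close> and \<open>X\<close> is on none of the
    chosen paths.\<close>
  define S where "S = (\<Union>x\<in>X. set (pp x) - X)"
  have "card S \<le> card X * (2 * l)"
  proof -
    have "card S \<le> (\<Sum>x\<in>X. card (set (pp x) - X))"
      unfolding S_def using X by (rule card_UN_le)
    also have "\<dots> \<le> (\<Sum>x\<in>X. 2 * l)"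
    proof (rule sum_mono)
      fix x assume x: "x \<in> X"
      have "card (set (pp x) - X) \<le> card (set (pp x))" by (intro card_mono) auto
      also have "\<dots> \<le> 2 * f x + 1" using pp[OF x] card_length[of "pp x"] by simp
      also have "\<dots> \<le> 2 * l" using A_bound[OF fA[OF x]] by simp
      finally show "card (set (pp x) - X) \<le> 2 * l" .
    qed
    finally show ?thesis by simp
  qed
  \<comment> \<open>Appending the edge to \<open>pp a\<close> would give
    \<open>f b \<ge> f a + 1\<close>, against \<open>f a = f b\<close>. If \<open>y\<close> lies in
    the level, it has to be strictly between \<open>a\<close> and \<open>b\<close> for the extension
    to be new and to satisfy \<open>mon\<close>.\<close>
  moreover have stuck: False
    if e: "{a, y, b} \<in> H" "a \<in> I" "b \<in> I" "\<rho> a < \<rho> b" "y \<noteq> b" "y \<notin> P" "y \<notin> S"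
      "y \<in> X \<Longrightarrow> \<rho> a < \<rho> y \<and> \<rho> y < \<rho> b" for a y b
  proof -
    have ab: "a \<in> X" "b \<in> X" "f a = f b" using e by (auto simp: I_def)
    let ?p = "pp a"
    have p: "mon ?p" "last ?p = a" "length ?p = 2 * f a + 1" using pp[OF ab(1)] by auto
    have ne: "?p \<noteq> []" using p(3) by auto
    have below: "\<rho> w \<le> \<rho> a" if "w \<in> set ?p" "w \<in> X" for w
      using p(1,2) that unfolding mon_def by auto
    have bn: "b \<notin> set ?p" using below[of b] ab e by auto
    have yn: "y \<notin> set ?p"
      using below[of y] e(7,8) ab by (cases "y \<in> X") (auto simp: S_def)
    have last_nth: "?p ! (2 * f a) = a" using p ne by (simp add: last_conv_nth)
    let ?q = "?p @ [y, b]"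
    have "loose_path H ?q" using p e(1) by (intro loose_path_snoc) (auto simp: mon_def)
    moreover have "distinct ?q" using p(1) bn yn e(5) by (auto simp: mon_def)
    moreover have "set ?q \<inter> P = {}" using p(1) e(6) linkedD(1)[OF lk] ab by (auto simp: mon_def)
    moreover have "?q ! (2 * t) \<in> X" if "2 * t < length ?q" for t
    proof (cases "t \<le> f a")
      case True
      then show ?thesis using p(1,3) by (auto simp: mon_def nth_append)
    next
      case False
      then have "t = f a + 1" using that p(3) by simp
      then show ?thesis using ab p(3) by (simp add: nth_append)
    qed
    moreover have "\<rho> (?q ! (2 * t)) < \<rho> (?q ! (2 * t + 2))" if "2 * t + 2 < length ?q" for t
    proof (cases "t < f a")
      case True
      then have "2 * t + 2 < length ?p" using p(3) by simp
      then show ?thesis using p(1) by (auto simp: mon_def nth_append)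
    next
      case False
      then have "t = f a" using that p(3) by simp
      then show ?thesis using e(4) p(3) last_nth by (simp add: nth_append)
    qed
    moreover have "\<forall>w\<in>set ?q \<inter> X. \<rho> w \<le> \<rho> (last ?q)"
      using below e(4,8) by force
    ultimately have "mon ?q" unfolding mon_def by blast
    then have "f a + 1 \<in> A b" unfolding A_def using p(3) by (auto intro!: exI[of _ ?q])
    then show False using f_ge ab(3) by fastforce
  qed
  have "card (e \<inter> I) \<le> 1" if eH: "e \<in> H" and av: "e \<inter> (S \<union> P \<union> (X - I)) = {}" for e
  proof (rule ccontr)
    assume "\<not> card (e \<inter> I) \<le> 1"
    moreover from this have "finite (e \<inter> I)" by (intro card_ge_0_finite) simp
    ultimately obtain a b where ab: "a \<in> e" "b \<in> e" "a \<in> I" "b \<in> I" "a \<noteq> b"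
      by (auto simp: card_le_Suc0_iff_eq)
    have "card e = 3" using H3 eH by blast
    then have "card (e - {a, b}) = 1"
      using ab card_ge_0_finite[of e] by (subst card_Diff_subset) auto
    then obtain y where y: "e - {a, b} = {y}" by (auto simp: card_1_singleton_iff)
    then have e: "e = {a, b, y}" and ya: "y \<noteq> a" "y \<noteq> b" using ab by blast+
    have yS: "y \<notin> S" "y \<notin> P" "y \<in> X \<Longrightarrow> y \<in> I" using av e by auto
    have inj: "\<rho> r \<noteq> \<rho> t" if "r \<in> X" "t \<in> X" "r \<noteq> t" for r t
      using inj_onD[OF linkedD(2)[OF lk] _ that(1,2)] that(3) by blast
    have IX: "I \<subseteq> X" and IP: "I \<inter> P = {}" "I \<inter> S = {}"
      using linkedD(1)[OF lk] by (auto simp: I_def S_def)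
    show False
    proof (cases "y \<in> X")
      case False
      have "\<rho> a \<noteq> \<rho> b" using ab IX by (intro inj) auto
      then have "\<rho> a < \<rho> b \<or> \<rho> b < \<rho> a" by linarith
      moreover have "{a, y, b} = e" "{b, y, a} = e" using e by auto
      ultimately show False
      proof (elim disjE)
        assume "\<rho> a < \<rho> b"
        then show False using stuck[of a y b] \<open>{a, y, b} = e\<close> ab ya yS False eH by blast
      next
        assume "\<rho> b < \<rho> a"
        then show False using stuck[of b y a] \<open>{b, y, a} = e\<close> ab ya yS False eH by blast
      qed
    next
      case True
      then have yI: "y \<in> I" using yS by blast
      have ne: "\<rho> a \<noteq> \<rho> b" "\<rho> a \<noteq> \<rho> y" "\<rho> b \<noteq> \<rho> y"
        using inj[of a b] inj[of a y] inj[of b y] ab ya yI IX by blast+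
      \<comment> \<open>With all three vertices in \<open>I\<close>, the middle one in the order
        serves as the inner vertex.\<close>
      have no: "\<not> (\<rho> r < \<rho> t \<and> \<rho> t < \<rho> v)" if "{r, t, v} = e" for r t v
      proof
        assume r: "\<rho> r < \<rho> t \<and> \<rho> t < \<rho> v"
        have "r \<in> I" "t \<in> I" "v \<in> I" using that e ab yI by auto
        then show False using stuck[of r t v] that eH IP r by force
      qed
      have "{a, b, y} = e" "{a, y, b} = e" "{b, a, y} = e" "{b, y, a} = e" "{y, a, b} = e"
        "{y, b, a} = e"
        using e by auto
      from this[THEN no] show False using ne by linarith
    qed
  qed
  moreover have "I \<subseteq> X" "finite S" "S \<inter> X = {}" using X by (auto simp: I_def S_def)
  ultimately show ?thesis using j unfolding I_def[symmetric]
    by (intro exI[of _ I] exI[of _ S]) (auto simp: mult.commute)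
qed

section \<open>Passing to the next level\<close>

text \<open>In each edge \<open>f\<close> the vertex in \<open>I\<close> is the parent
  \<open>xf f\<close>, and of the other two \<open>yf f\<close> is the child and \<open>wf f\<close>
  the inner vertex. Siblings are linked through their parent; other children climb to their parents
  and use the old link, which adds two edges.\<close>

lemma linked_expand:
  assumes lk: "linked H (K + 4) i X P \<rho> d" and "I \<subseteq> X" and F: "finite F" "F \<subseteq> H"
    and H3: "\<forall>e\<in>H. card e = 3"
    and single: "\<And>f. f \<in> F \<Longrightarrow> card (f \<inter> I) = 1" and avoid: "\<And>f. f \<in> F \<Longrightarrow> f \<inter> P = {}"
    and disj: "\<And>f g. f \<in> F \<Longrightarrow> g \<in> F \<Longrightarrow> f \<noteq> g \<Longrightarrow> (f - I) \<inter> (g - I) = {}"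
  shows "\<exists>Y P' \<rho>' d'. linked H K (i + 1) Y P' \<rho>' d' \<and> Y \<subseteq> \<Union>F \<and> card Y = card F \<and>
           P' \<subseteq> P \<union> I \<union> \<Union>F \<and> card P' \<le> card P + card I + card F"
proof -
  have "\<exists>x y w. f = {x, y, w} \<and> x \<in> I \<and> y \<notin> I \<and> w \<notin> I \<and> y \<noteq> w" if f: "f \<in> F" for f
  proof -
    have 3: "card f = 3" "finite f" using H3 F f card_ge_0_finite[of f] by auto
    obtain x where x: "f \<inter> I = {x}" using single[OF f] by (auto simp: card_1_singleton_iff)
    have "card (f - I) = 2" using 3 single[OF f] by (simp add: card_Diff_subset_Int)
    then obtain y w where "f - I = {y, w}" "y \<noteq> w" by (auto simp: card_2_iff)
    then show ?thesis using x by blast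
  qed
  then obtain xf yf wf where fe: "\<And>f. f \<in> F \<Longrightarrow> f = {xf f, yf f, wf f} \<and> xf f \<in> I \<and>
      yf f \<notin> I \<and> wf f \<notin> I \<and> yf f \<noteq> wf f"
    by metis
  define Y where "Y = yf ` F"
  have inj: "inj_on yf F"
    using disj fe by (intro inj_onI) (metis Diff_iff IntI empty_iff insertI1 insertI2)
  define fo where "fo = inv_into F yf"
  define px where "px v = xf (fo v)" for v
  define pw where "pw v = wf (fo v)" for v
  have fo: "fo v \<in> F" "yf (fo v) = v" if "v \<in> Y" for v
    using that unfolding fo_def Y_def by (auto intro: inv_into_into f_inv_into_f)
  have edge: "fo v = {px v, v, pw v}" and pxI: "px v \<in> I" and out: "v \<notin> I" "pw v \<notin> I" "v \<noteq> pw v"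
    if "v \<in> Y" for v
    using fe[OF fo(1)[OF that]] fo(2)[OF that] by (auto simp: px_def pw_def)
  have edgeH: "{px v, v, pw v} \<in> H" if "v \<in> Y" for v
    using edge[OF that] fo(1)[OF that] F by auto
  have sep: "{v, pw v} \<inter> {v', pw v'} = {}" if "v \<in> Y" "v' \<in> Y" "v \<noteq> v'" for v v'
  proof -
    have "fo v \<noteq> fo v'" using fo that by metis
    then have "(fo v - I) \<inter> (fo v' - I) = {}" using disj fo that by blast
    then show ?thesis using edge out that by auto
  qed
  have offP: "v \<notin> P" "pw v \<notin> P" if "v \<in> Y" for v
    using avoid[OF fo(1)[OF that]] edge[OF that] by auto
  define P' where "P' = P \<union> I \<union> pw ` Y"
  have finY: "finite Y" using F by (simp add: Y_def)
  obtain g where g: "bij_betw g Y {0..<card Y}" using ex_bij_betw_finite_nat[OF finY] by blast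
  define B where "B = card Y"
  have gB: "g v < B" if "v \<in> Y" for v using g that by (auto simp: bij_betw_def B_def)
  have g_inj: "v = v'" if "v \<in> Y" "v' \<in> Y" "g v = g v'" for v v'
    using g that by (auto simp: bij_betw_def dest: inj_onD)
  \<comment> \<open>Lexicographic order with the parent first: siblings are consecutive, so
    \<open>d'\<close> inherits the ultrametric rule.\<close>
  define \<rho>' where "\<rho>' v = \<rho> (px v) * B + g v" for v
  have mono: "\<rho> (px v) \<le> \<rho> (px v')" if "v \<in> Y" "v' \<in> Y" "\<rho>' v < \<rho>' v'" for v v'
  proof (rule ccontr)
    assume "\<not> ?thesis"
    then have "Suc (\<rho> (px v')) * B \<le> \<rho> (px v) * B" by (intro mult_right_mono) auto
    then show False using that gB[OF that(2)] by (simp add: \<rho>'_def)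
  qed
  have pxX: "px v \<in> X" if "v \<in> Y" for v using pxI[OF that] \<open>I \<subseteq> X\<close> by blast
  have strict: "\<rho> (px v) < \<rho> (px v')" if "v \<in> Y" "v' \<in> Y" "\<rho>' v < \<rho>' v'" "px v \<noteq> px v'" for v v'
    using mono[OF that(1-3)] inj_onD[OF linkedD(2)[OF lk] _ pxX[OF that(1)] pxX[OF that(2)]] that(4)
    by (meson le_neq_implies_less)
  define d' where "d' v v' = (if px v = px v' then 1 else d (px v) (px v') + 1)" for v v'
  have in_F: "v \<in> \<Union>F \<and> pw v \<in> \<Union>F" if "v \<in> Y" for v
    using edge[OF that] by (intro conjI UnionI[OF fo(1)[OF that]]) auto
  have "linked H K (i + 1) Y P' \<rho>' d'"
    unfolding linked_def
  proof (intro conjI ballI impI allI)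
    show "Y \<inter> P' = {}"
    proof -
      have "pw v \<noteq> v'" if "v \<in> Y" "v' \<in> Y" for v v'
        using sep[OF that] out(3)[OF that(1)] by (cases "v = v'") auto
      then show ?thesis using offP out(1) by (auto simp: P'_def)
    qed
    show "inj_on \<rho>' Y"
    proof (rule inj_onI)
      fix v v' assume v: "v \<in> Y" "v' \<in> Y" "\<rho>' v = \<rho>' v'"
      then have "(\<rho> (px v) * B + g v) mod B = (\<rho> (px v') * B + g v') mod B" by (simp add: \<rho>'_def)
      then show "v = v'" using g_inj[OF v(1,2)] gB v by simp
    qed
  next
    fix v v' assume v: "v \<in> Y" "v' \<in> Y" "\<rho>' v < \<rho>' v'"
    have vv: "v \<noteq> v'" using v by auto
    show "1 \<le> d' v v'" by (simp add: d'_def)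
    show "d' v v' \<le> i + 1"
      using linkedD(3)[OF lk pxX[OF v(1)] pxX[OF v(2)] strict[OF v]] by (auto simp: d'_def)
    fix Q assume Q: "finite Q \<and> card Q \<le> K \<and> Q \<inter> P' = {} \<and> v \<notin> Q \<and> v' \<notin> Q"
    have pQ: "px v \<notin> Q" "px v' \<notin> Q" "pw v \<notin> Q" "pw v' \<notin> Q"
      using Q pxI v unfolding P'_def by auto
    have e1: "loose_path H [v, pw v, px v]"
      using edgeH[OF v(1)] by (intro loose_path_edge) (simp add: insert_commute)
    have e2: "{px v', pw v', v'} \<in> H"
      using edgeH[OF v(2)] by (simp add: insert_commute)
    have dist4: "v \<noteq> pw v" "v' \<noteq> pw v'" "v \<noteq> pw v'" "v' \<noteq> pw v" "pw v \<noteq> pw v'"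
      using sep[OF v(1,2) vv] out(3) v by auto
    have pxne: "px v \<noteq> v" "px v \<noteq> v'" "px v \<noteq> pw v" "px v \<noteq> pw v'"
       "px v' \<noteq> v" "px v' \<noteq> v'" "px v' \<noteq> pw v" "px v' \<noteq> pw v'"
      using out(1,2)[OF v(1)] out(1,2)[OF v(2)] pxI[OF v(1)] pxI[OF v(2)] by metis+
    show "\<exists>p. loose_path H p \<and> distinct p \<and> hd p = v \<and> last p = v' \<and>
               length p = 4 * d' v v' + 1 \<and> set p \<inter> Q = {}"
    proof (cases "px v = px v'")
      case True
      have "loose_path H ([v, pw v, px v] @ [pw v', v'])"
        using e2 True by (intro loose_path_snoc[OF e1]) auto
      then show ?thesis
        using True Q pQ dist4 pxne vv
        by (intro exI[of _ "[v, pw v, px v, pw v', v']"]) (auto simp: d'_def)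
    next
      case False
      \<comment> \<open>The old link must also miss both children and both inner vertices; these
        four account for the drop from \<open>K + 4\<close> to \<open>K\<close>.\<close>
      define Q' where "Q' = Q \<union> {v, v', pw v, pw v'}"
      have "card Q' \<le> card Q + card {v, v', pw v, pw v'}" unfolding Q'_def by (rule card_Un_le)
      also have "\<dots> \<le> K + 4" using Q dist4 vv by simp
      finally have "card Q' \<le> K + 4" .
      moreover have "finite Q'" "Q' \<inter> P = {}" "px v \<notin> Q'" "px v' \<notin> Q'"
        using Q pQ offP v pxne by (auto simp: Q'_def P'_def)
      ultimately obtain p where p: "loose_path H p" "distinct p" "hd p = px v" "last p = px v'"
        "length p = 4 * d (px v) (px v') + 1" "set p \<inter> Q' = {}"
        using linkedD(4)[OF lk pxX[OF v(1)] pxX[OF v(2)] strict[OF v False], of Q'] by auto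
      have ne: "p \<noteq> []" using p(5) by auto
      have "[v, pw v, px v] @ tl p = [v, pw v] @ p" using p(3) ne by (cases p) auto
      then have "loose_path H ([v, pw v] @ p)"
        using loose_path_join[OF e1 p(1)] p(3) by simp
      then have "loose_path H (([v, pw v] @ p) @ [pw v', v'])"
        using e2 p(4) ne by (intro loose_path_snoc) auto
      moreover have "distinct (([v, pw v] @ p) @ [pw v', v'])"
        using p(2,6) dist4 vv by (auto simp: Q'_def)
      moreover have "set (([v, pw v] @ p) @ [pw v', v']) \<inter> Q = {}"
        using p(6) Q pQ by (auto simp: Q'_def)
      moreover have "length (([v, pw v] @ p) @ [pw v', v']) = 4 * d' v v' + 1"
        using p(5) False by (simp add: d'_def)
      ultimately show ?thesis
        by (intro exI[of _ "([v, pw v] @ p) @ [pw v', v']"]) auto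
    qed
  next
    fix a b c assume v: "a \<in> Y" "b \<in> Y" "c \<in> Y" "\<rho>' a < \<rho>' b" "\<rho>' b < \<rho>' c"
    have ac: "\<rho>' a < \<rho>' c" using v by simp
    show "d' a c = max (d' a b) (d' b c)"
    \<comment> \<open>The vertices \<open>a\<close> and \<open>c\<close> cannot share a parent
      different from that of \<open>b\<close>, which lies between them.\<close>
    proof (cases "px a = px b \<or> px b = px c")
      case True
      then show ?thesis by (auto simp: d'_def)
    next
      case False
      then have s: "\<rho> (px a) < \<rho> (px b)" "\<rho> (px b) < \<rho> (px c)" using strict v by auto
      then have "px a \<noteq> px c" by auto
      then show ?thesis
        using False linkedD(5)[OF lk pxX[OF v(1)] pxX[OF v(2)] pxX[OF v(3)] s]
        by (simp add: d'_def)
    qed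
  qed
  moreover have "Y \<subseteq> \<Union>F" "P' \<subseteq> P \<union> I \<union> \<Union>F"
    unfolding P'_def using in_F by blast+
  moreover have cY: "card Y = card F" unfolding Y_def by (rule card_image[OF inj])
  moreover have "card P' \<le> card P + card I + card F"
  proof -
    have "card P' \<le> card (P \<union> I) + card (pw ` Y)" unfolding P'_def by (rule card_Un_le)
    also have "\<dots> \<le> (card P + card I) + card Y"
      using card_Un_le[of P I] card_image_le[OF finY, of pw] by (rule add_mono)
    finally show ?thesis using cY by simp
  qed
  ultimately show ?thesis by blast
qed

section \<open>The first level\<close>

text \<open>Leaves with \<open>u a \<noteq> u b\<close> are linked through the centre
  \<open>y\<close>. If \<open>u a = u b\<close>, this common vertex becomes the middle joint, and
  the heavy pairs supply two fresh inner vertices.\<close>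

lemma linked_star:
  assumes X: "finite X" and H3: "\<forall>e\<in>H. card e = 3"
    and edge: "\<And>z. z \<in> X \<Longrightarrow> {y, z, u z} \<in> H" and "y \<notin> X" and u: "\<And>z. z \<in> X \<Longrightarrow> u z \<noteq> y"
    and "u ` X \<inter> X = {}"
    and heavy: "\<And>z z'. z \<in> X \<Longrightarrow> z' \<in> X \<Longrightarrow> z \<noteq> z' \<Longrightarrow> u z = u z' \<Longrightarrow>
                  K + 4 < card {e \<in> H. {z, u z} \<subseteq> e}"
  shows "\<exists>\<rho> d. linked H K 1 X (insert y (u ` X)) \<rho> d"
proof -
  obtain \<rho> where \<rho>: "bij_betw \<rho> X {0..<card X}" using ex_bij_betw_finite_nat[OF X] by blast
  have "linked H K 1 X (insert y (u ` X)) \<rho> (\<lambda>_ _. 1)"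
    unfolding linked_def
  proof (intro conjI ballI impI allI)
    show "X \<inter> insert y (u ` X) = {}" using assms by auto
    show "inj_on \<rho> X" using \<rho> by (simp add: bij_betw_def)
  next
    fix a b Q assume ab: "a \<in> X" "b \<in> X" "\<rho> a < \<rho> b"
      and Q: "finite Q \<and> card Q \<le> K \<and> Q \<inter> insert y (u ` X) = {} \<and> a \<notin> Q \<and> b \<notin> Q"
    have ne: "a \<noteq> b" "a \<noteq> y" "b \<noteq> y" "u a \<noteq> y" "u b \<noteq> y" using ab u \<open>y \<notin> X\<close> by auto
    have un: "u a \<noteq> a" "u a \<noteq> b" "u b \<noteq> a" "u b \<noteq> b" using \<open>u ` X \<inter> X = {}\<close> ab by auto
    have off: "y \<notin> Q" "u a \<notin> Q" "u b \<notin> Q" using Q ab by auto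
    show "\<exists>p. loose_path H p \<and> distinct p \<and> hd p = a \<and> last p = b \<and> length p = 4 * 1 + 1 \<and>
            set p \<inter> Q = {}"
    proof (cases "u a = u b")
      case False
      have "loose_path H [a, u a, y]"
        using edge[OF ab(1)] by (intro loose_path_edge) (simp add: insert_commute)
      then have "loose_path H ([a, u a, y] @ [u b, b])"
        using edge[OF ab(2)] by (intro loose_path_snoc) (auto simp: insert_commute)
      then show ?thesis
        using False ne un off Q by (intro exI[of _ "[a, u a, y, u b, b]"]) auto
    next
      case True
      have "card (insert b Q) < card {e \<in> H. {a, u a} \<subseteq> e}"
        using heavy[OF ab(1,2) ne(1) True] Q by (simp add: card_insert_if)
      then obtain r where r: "r \<notin> insert b Q" "r \<noteq> a" "r \<noteq> u a" "{a, u a, r} \<in> H"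
        using extend_heavy_pair[OF H3 un(1)[symmetric]] Q by (metis finite_insert)
      have "card (insert r (insert a Q)) < card {e \<in> H. {b, u b} \<subseteq> e}"
        using heavy[OF ab(2,1) ne(1)[symmetric] True[symmetric]] Q
        by (simp add: card_insert_if)
      then obtain t where t: "t \<notin> insert r (insert a Q)" "t \<noteq> b" "t \<noteq> u b" "{b, u b, t} \<in> H"
        using extend_heavy_pair[OF H3 un(4)[symmetric]] Q by (metis finite_insert)
      have "loose_path H [a, r, u a]"
        using r(4) by (intro loose_path_edge) (simp add: insert_commute)
      then have "loose_path H ([a, r, u a] @ [t, b])"
        using t(4) True by (intro loose_path_snoc) (auto simp: insert_commute)
      then show ?thesis
        using True ne un off Q r t by (intro exI[of _ "[a, r, u a, t, b]"]) auto
    qed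
  qed auto
  then show ?thesis by blast
qed

text \<open>Greedy choice: preimages average at most one per vertex, so some \<open>z\<close> has at
  most one in \<open>Z\<close>. Keeping \<open>z\<close> costs only \<open>z\<close>,
  \<open>u z\<close> and that preimage.\<close>

lemma fixpoint_free_third:
  assumes "finite Z" "\<And>z. z \<in> Z \<Longrightarrow> u z \<noteq> z"
  shows "\<exists>X \<subseteq> Z. u ` X \<inter> X = {} \<and> card Z \<le> 3 * card X"
  using assms
proof (induction "card Z" arbitrary: Z rule: less_induct)
  case less
  show ?case
  proof (cases "Z = {}")
    case True
    then show ?thesis by auto
  next
    case False
    have "\<exists>z\<in>Z. card {x \<in> Z. u x = z} \<le> 1"
    proof (rule ccontr)
      assume "\<not> ?thesis"
      then have "(\<Sum>z\<in>Z. 2) \<le> (\<Sum>z\<in>Z. card {x \<in> Z. u x = z})" by (intro sum_mono) force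
      also have "\<dots> = (\<Sum>z\<in>Z. card {x \<in> {x \<in> Z. u x \<in> Z}. u x = z})"
        by (intro sum.cong) (auto intro: arg_cong[where f = card])
      also have "\<dots> = card {x \<in> Z. u x \<in> Z}"
        using sum.group[of "{x \<in> Z. u x \<in> Z}" Z u "\<lambda>_. 1 :: nat"] less.prems(1)
        by (simp add: image_subset_iff)
      also have "\<dots> \<le> card Z" using less.prems(1) by (intro card_mono) auto
      finally show False using False less.prems(1) by simp
    qed
    then obtain z where z: "z \<in> Z" "card {x \<in> Z. u x = z} \<le> 1" by blast
    define R where "R = insert z (insert (u z) {x \<in> Z. u x = z})"
    have "card R \<le> Suc (Suc (card {x \<in> Z. u x = z}))"
      unfolding R_def using less.prems(1) by (simp add: card_insert_if)
    then have R: "card R \<le> 3" using z by simp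
    have "card (Z - R) < card Z"
      using less.prems(1) z by (intro psubset_card_mono) (auto simp: R_def)
    then obtain X where X: "X \<subseteq> Z - R" "u ` X \<inter> X = {}" "card (Z - R) \<le> 3 * card X"
      using less.hyps[of "Z - R"] less.prems by auto
    have "u ` insert z X \<inter> insert z X = {}"
      using X less.prems(2)[OF z(1)] z by (auto simp: R_def)
    moreover have "card Z \<le> 3 * card (insert z X)"
    proof -
      have "finite R" using less.prems(1) by (simp add: R_def)
      then have "card Z \<le> card (Z - R) + card R"
        using diff_card_le_card_Diff[of R Z] by linarith
      moreover have "z \<notin> X" "finite X" using X less.prems(1) by (auto simp: R_def dest: finite_subset)
      ultimately show ?thesis using X(3) R by simp
    qed
    ultimately show ?thesis using X z by (intro exI[of _ "insert z X"]) auto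
  qed
qed

text \<open>
  The root \<open>y\<close> of an edge is chosen such that either both of its pairs are light, or one
  is light and the pair opposite to \<open>y\<close> is heavy. In the second case two edges \<open>{y, z, u}\<close>, \<open>{y, z', u}\<close>
  sharing \<open>u\<close> do not form a loose path, but the heavy pairs \<open>{z, u}\<close> and \<open>{z', u}\<close> extend to one.
\<close>

lemma light_root:
  assumes "card e = 3" "a \<in> e" "b \<in> e" "a \<noteq> b" "{a, b} \<in> L"
  shows "\<exists>y z u. e = {y, z, u} \<and> y \<noteq> z \<and> y \<noteq> u \<and> z \<noteq> u \<and> {y, z} \<in> L \<and> ({y, u} \<in> L \<or> {z, u} \<notin> L)"
proof -
  have "finite e" using assms(1) by (intro card_ge_0_finite) simp
  then have "card (e - {a, b}) = 1" using assms by (subst card_Diff_subset) auto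
  then obtain c where c: "e - {a, b} = {c}" by (auto simp: card_1_singleton_iff)
  then have e: "e = {a, b, c}" "a \<noteq> c" "b \<noteq> c" using assms by blast+
  show ?thesis
  proof (cases "{b, c} \<in> L")
    case True
    then show ?thesis
      using e assms by (intro exI[of _ b] exI[of _ a] exI[of _ c]) (auto simp: insert_commute)
  next
    case False
    then show ?thesis using e assms by (intro exI[of _ a] exI[of _ b] exI[of _ c]) auto
  qed
qed

lemma card_le_fibres:
  assumes "finite A" "\<And>b. b \<in> f ` A \<Longrightarrow> card {a \<in> A. f a = b} \<le> C"
  shows "card A \<le> C * card (f ` A)"
proof (cases "A = {}")
  case False
  then obtain b where b: "b \<in> f ` A" "card A \<le> card (f ` A) * card {a \<in> A. f a = b}"
    using fibre_pigeonhole[OF assms(1) _ subset_refl False] assms(1) by auto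
  note b(2)
  also have "card (f ` A) * card {a \<in> A. f a = b} \<le> card (f ` A) * C"
    using assms(2)[OF b(1)] by simp
  finally show ?thesis by (simp add: mult.commute)
qed simp

text \<open>The factor \<open>6 * C\<^sup>2 * card W\<close> multiplies the successive losses:
  \<open>card W\<close> for fixing the root, 2 for the kind of edge, \<open>C\<close> for passing
  from edges to leaves, 3 for separating leaves from inner vertices, and \<open>C\<close> for making
  inner vertices distinct.\<close>

lemma dense_imp_linked_level:
  assumes W: "finite W" "\<forall>e\<in>H. e \<subseteq> W" and H3: "\<forall>e\<in>H. card e = 3" and "H \<noteq> {}" and l: "3 \<le> l"
    and C: "2 * l < C" "C = K + 5"
    and free: "\<not> (\<exists>Z \<subseteq> H. loose_cycle 3 l Z)"
  shows "\<exists>X P \<rho> d. linked H K 1 X P \<rho> d \<and> X \<subseteq> W \<and> finite P \<and> card P \<le> 1 + card X \<and>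
           card H \<le> 6 * C\<^sup>2 * card W * card X"
proof -
  have finH: "finite H" using W by (intro finite_subset[of H "Pow W"]) auto
  obtain L where L: "\<forall>e\<in>H. \<exists>a\<in>e. \<exists>b\<in>e. a \<noteq> b \<and> {a, b} \<in> L e"
     and L_light: "\<And>Q. card {e \<in> H. Q \<subseteq> e \<and> Q \<in> L e} < C"
     and L_heavy: "\<And>e Q. e \<in> H \<Longrightarrow> Q \<notin> L e \<Longrightarrow> C \<le> card {e \<in> H. Q \<subseteq> e}"
    using light_pair_assignment[OF finH H3 l C(1) free] by blast
  have "\<exists>y z u. e = {y, z, u} \<and> y \<noteq> z \<and> y \<noteq> u \<and> z \<noteq> u \<and> {y, z} \<in> L e \<and> ({y, u} \<in> L e \<or> {z, u} \<notin> L e)"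
    if "e \<in> H" for e
  proof -
    from L that obtain a b where "a \<in> e" "b \<in> e" "a \<noteq> b" "{a, b} \<in> L e" by blast
    then show ?thesis using H3 that by (intro light_root) auto
  qed
  then obtain yf zf uf where fe: "\<And>e. e \<in> H \<Longrightarrow> e = {yf e, zf e, uf e} \<and> yf e \<noteq> zf e \<and>
      yf e \<noteq> uf e \<and> zf e \<noteq> uf e \<and> {yf e, zf e} \<in> L e \<and> ({yf e, uf e} \<in> L e \<or> {zf e, uf e} \<notin> L e)"
    by metis
  have "yf ` H \<subseteq> W" using fe W(2) by blast
  then obtain y where y: "y \<in> W" "card H \<le> card W * card {e \<in> H. yf e = y}"
    using fibre_pigeonhole[OF finH W(1) _ \<open>H \<noteq> {}\<close>] by blast
  define F where "F = {e \<in> H. yf e = y}"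
  have cH: "card H \<le> card W * card F" using y by (simp add: F_def)
  have finF: "finite F" using finH by (simp add: F_def)
  have "F \<noteq> {}" using cH \<open>H \<noteq> {}\<close> finH by auto
  \<comment> \<open>The two kinds of edge: both pairs at the root are light, or else the pair
    opposite to the root is heavy.\<close>
  define \<phi> where "\<phi> e \<longleftrightarrow> {yf e, uf e} \<in> L e" for e
  obtain t where t: "card F \<le> card (UNIV :: bool set) * card {e \<in> F. \<phi> e = t}"
    using fibre_pigeonhole[OF finF _ _ \<open>F \<noteq> {}\<close>, of UNIV \<phi>] by auto
  define F' where "F' = {e \<in> F. \<phi> e = t}"
  have cF: "card F \<le> 2 * card F'" using t by (simp add: F'_def)
  have finF': "finite F'" using finF by (simp add: F'_def)
  have F'H: "F' \<subseteq> H" by (auto simp: F'_def F_def)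
  have F'y: "yf e = y" if "e \<in> F'" for e using that by (simp add: F'_def F_def)
  define Z where "Z = zf ` F'"
  have cF': "card F' \<le> C * card Z"
    unfolding Z_def
  proof (rule card_le_fibres[OF finF'])
    fix z
    have "{e \<in> F'. zf e = z} \<subseteq> {e \<in> H. {y, z} \<subseteq> e \<and> {y, z} \<in> L e}"
      using fe F'H F'y by blast
    then have "card {e \<in> F'. zf e = z} \<le> card {e \<in> H. {y, z} \<subseteq> e \<and> {y, z} \<in> L e}"
      using finH by (intro card_mono) auto
    then show "card {e \<in> F'. zf e = z} \<le> C" using L_light[of "{y, z}"] by simp
  qed
  define s where "s = inv_into F' zf"
  have s: "s z \<in> F'" "zf (s z) = z" if "z \<in> Z" for z
    using that unfolding s_def Z_def by (auto intro: inv_into_into f_inv_into_f)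
  have s_inj: "inj_on s Z" using s(2) by (metis inj_onI)
  define u where "u z = uf (s z)" for z
  have sz: "s z = {y, z, u z}" "y \<noteq> z" "y \<noteq> u z" "z \<noteq> u z" "{y, z} \<in> L (s z)"
    "t \<Longrightarrow> {y, u z} \<in> L (s z)" "\<not> t \<Longrightarrow> {z, u z} \<notin> L (s z)" "s z \<in> H"
    if "z \<in> Z" for z
  proof -
    have H: "s z \<in> H" using s(1)[OF that] F'H by blast
    have "\<phi> (s z) = t" using s(1)[OF that] by (simp add: F'_def)
    then show "s z = {y, z, u z}" "y \<noteq> z" "y \<noteq> u z" "z \<noteq> u z" "{y, z} \<in> L (s z)"
      "t \<Longrightarrow> {y, u z} \<in> L (s z)" "\<not> t \<Longrightarrow> {z, u z} \<notin> L (s z)" "s z \<in> H"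
      using fe[OF H] F'y[OF s(1)[OF that]] s(2)[OF that] H by (auto simp: u_def \<phi>_def)
  qed
  have finZ: "finite Z" using finF' by (simp add: Z_def)
  obtain X1 where X1: "X1 \<subseteq> Z" "u ` X1 \<inter> X1 = {}" "card Z \<le> 3 * card X1"
    using fixpoint_free_third[OF finZ, of u] sz(4) by metis
  have finX1: "finite X1" using X1 finZ finite_subset by blast
  \<comment> \<open>For the first kind the pairs \<open>{y, u z}\<close> are light, so fibres of
    \<open>u\<close> are small and \<open>u\<close> can be made injective. For the second kind
    leaves may share \<open>u z\<close>, since the pairs \<open>{z, u z}\<close> are heavy.\<close>
  obtain X where X: "X \<subseteq> X1" "card X1 \<le> C * card X" "t \<Longrightarrow> inj_on u X"
  proof (cases t)
    case False
    then show ?thesis using that[of X1] C by simp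
  next
    case True
    define X where "X = inv_into X1 u ` (u ` X1)"
    have "X \<subseteq> X1" unfolding X_def by (auto intro: inv_into_into)
    moreover have "inj_on u X" unfolding X_def by (auto intro!: inj_onI simp: f_inv_into_f)
    moreover have "card X1 \<le> C * card (u ` X1)"
    proof (rule card_le_fibres[OF finX1])
      fix v
      have "card {x \<in> X1. u x = v} = card (s ` {x \<in> X1. u x = v})"
        using X1(1) s_inj by (intro card_image[symmetric]) (auto intro: inj_on_subset)
      also have "\<dots> \<le> card {e \<in> H. {y, v} \<subseteq> e \<and> {y, v} \<in> L e}"
      proof (intro card_mono)
        show "s ` {x \<in> X1. u x = v} \<subseteq> {e \<in> H. {y, v} \<subseteq> e \<and> {y, v} \<in> L e}"
        proof
          fix e assume "e \<in> s ` {x \<in> X1. u x = v}"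
          then obtain x where x: "x \<in> Z" "u x = v" "e = s x" using X1(1) by auto
          show "e \<in> {e \<in> H. {y, v} \<subseteq> e \<and> {y, v} \<in> L e}"
            using sz(1,6,8)[OF x(1)] x True by auto
        qed
      qed (use finH in auto)
      finally show "card {x \<in> X1. u x = v} \<le> C" using L_light[of "{y, v}"] by simp
    qed
    moreover have "card X = card (u ` X1)"
      unfolding X_def by (intro card_image inj_on_inv_into) simp
    ultimately show ?thesis using that[of X] by simp
  qed
  have XZ: "X \<subseteq> Z" using X X1 by blast
  have finX: "finite X" using finX1 X finite_subset by blast
  have "\<exists>\<rho> d. linked H K 1 X (insert y (u ` X)) \<rho> d"
  proof (rule linked_star[OF finX H3])
    show "{y, z, u z} \<in> H" if "z \<in> X" for z using sz(1,8)[of z] XZ that by auto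
    show "y \<notin> X" using sz(2) XZ by blast
    show "u z \<noteq> y" if "z \<in> X" for z using sz(3)[of z] XZ that by auto
    show "u ` X \<inter> X = {}" using X1(2) X(1) by blast
    fix z z' assume z: "z \<in> X" "z' \<in> X" "z \<noteq> z'" "u z = u z'"
    then have "\<not> t" using X(3) by (auto dest: inj_onD)
    then have "C \<le> card {e \<in> H. {z, u z} \<subseteq> e}"
      using z XZ sz(7,8)[of z] by (intro L_heavy[of "s z"]) auto
    then show "K + 4 < card {e \<in> H. {z, u z} \<subseteq> e}" using C by simp
  qed
  moreover have "X \<subseteq> W"
  proof
    fix z assume "z \<in> X"
    then have "z \<in> s z" "s z \<in> H" using sz(1,8)[of z] XZ by auto
    then show "z \<in> W" using W(2) by blast
  qed
  moreover have "card (insert y (u ` X)) \<le> 1 + card X"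
    using card_image_le[OF finX, of u] finX by (simp add: card_insert_if)
  moreover have "card H \<le> 6 * C\<^sup>2 * card W * card X"
  proof -
    have "card F' \<le> C * (3 * (C * card X))"
      using cF' X1(3) X(2) by (meson le_trans mult_le_mono2)
    then have "card F \<le> 2 * (C * (3 * (C * card X)))" using cF by linarith
    then have "card H \<le> card W * (2 * (C * (3 * (C * card X))))"
      using cH by (meson le_trans mult_le_mono2)
    then show ?thesis by (simp add: power2_eq_square algebra_simps)
  qed
  ultimately show ?thesis using finX by (metis finite_imageI finite_insert)
qed

section \<open>Growing the levels\<close>

text \<open>Take a maximal family \<open>F\<close> of edges that meet \<open>I\<close>, miss the
  exceptional set \<open>M0\<close> and are disjoint outside \<open>I\<close>. By maximality
  \<open>M0\<close> and the outer vertices of \<open>F\<close> together hit every edge meeting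
  \<open>I\<close>; either this hitting set is small, or \<open>F\<close> is large and yields the
  next level.\<close>

lemma linked_level_step:
  fixes \<tau> :: real
  assumes lk: "linked H (K + 4) i X P \<rho> d" and l: "2 * i < l" "2 * l \<le> K + 4" "3 \<le> l"
    and W: "finite W" "\<forall>e\<in>H. e \<subseteq> W" and X: "X \<subseteq> W" "X \<noteq> {}"
    and P: "finite P" "card P \<le> 2 * card X"
    and H3: "\<forall>e\<in>H. card e = 3" and free: "\<not> (\<exists>C \<subseteq> H. loose_cycle 3 l C)"
    and \<tau>: "2 * real (l * (2 * l + 3)) \<le> \<tau>"
  shows "(\<exists>I M. I \<subseteq> W \<and> I \<noteq> {} \<and> I \<inter> M = {} \<and> finite M \<and> real (card M) \<le> \<tau> * card I \<and>
            (\<forall>e\<in>H. e \<inter> I \<noteq> {} \<longrightarrow> e \<inter> M \<noteq> {})) \<or>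
         (\<exists>Y P' \<rho>' d'. linked H K (i + 1) Y P' \<rho>' d' \<and> Y \<subseteq> W \<and> Y \<noteq> {} \<and> finite P' \<and>
            card P' \<le> 2 * card Y \<and> \<tau> * card X \<le> 4 * l * card Y)"
proof -
  have finX: "finite X" using X W finite_subset by blast
  have finH: "finite H" using W by (intro finite_subset[of H "Pow W"]) auto
  obtain I S where I: "I \<subseteq> X" "card X \<le> l * card I" and S: "finite S" "S \<inter> X = {}"
    "card S \<le> 2 * l * card X"
    and one: "\<forall>e\<in>H. e \<inter> (S \<union> P \<union> (X - I)) = {} \<longrightarrow> card (e \<inter> I) \<le> 1"
    using linked_level_sparse_subset[OF lk l finX H3 free] by (elim exE conjE)
  have finI: "finite I" using I finX finite_subset by blast
  have "I \<noteq> {}" using I(2) X(2) finX by auto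
  define M0 where "M0 = S \<union> P \<union> (X - I)"
  have finM0: "finite M0" using S P finX by (simp add: M0_def)
  have M0I: "M0 \<inter> I = {}" using S linkedD(1)[OF lk] I by (auto simp: M0_def)
  have "card M0 \<le> card S + card P + card (X - I)"
    unfolding M0_def by (meson add_mono card_Un_le le_refl le_trans)
  also have "\<dots> \<le> 2 * l * card X + 2 * card X + card X"
    using S(3) P(2) card_mono[OF finX, of "X - I"] by (intro add_mono) auto
  also have "\<dots> = (2 * l + 3) * card X" by (simp add: algebra_simps)
  also have "\<dots> \<le> (2 * l + 3) * (l * card I)" using I(2) by (rule mult_le_mono2)
  finally have cM0: "card M0 \<le> l * (2 * l + 3) * card I" by (simp add: algebra_simps)
  define \<F> where "\<F> = {F. F \<subseteq> H \<and> (\<forall>f\<in>F. f \<inter> I \<noteq> {} \<and> f \<inter> M0 = {}) \<and>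
     (\<forall>f\<in>F. \<forall>g\<in>F. f \<noteq> g \<longrightarrow> (f - I) \<inter> (g - I) = {})}"
  have "finite \<F>" using finH by (intro finite_subset[of \<F> "Pow H"]) (auto simp: \<F>_def)
  moreover have "{} \<in> \<F>" by (simp add: \<F>_def)
  ultimately obtain F where F: "F \<in> \<F>" and max: "\<And>G. G \<in> \<F> \<Longrightarrow> F \<subseteq> G \<Longrightarrow> G = F"
    using finite_has_maximal[of \<F>] by blast
  have FH: "F \<subseteq> H" and Fp: "\<And>f. f \<in> F \<Longrightarrow> f \<inter> I \<noteq> {} \<and> f \<inter> M0 = {}"
    and Fd: "\<And>f g. f \<in> F \<Longrightarrow> g \<in> F \<Longrightarrow> f \<noteq> g \<Longrightarrow> (f - I) \<inter> (g - I) = {}"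
    using F by (auto simp: \<F>_def)
  have finF: "finite F" using FH finH finite_subset by blast
  have single: "card (f \<inter> I) = 1" if "f \<in> H" "f \<inter> I \<noteq> {}" "f \<inter> M0 = {}" for f
  proof -
    have "card (f \<inter> I) \<le> 1" using one that by (simp add: M0_def)
    moreover have "card (f \<inter> I) > 0" using that finI by (simp add: card_gt_0_iff)
    ultimately show ?thesis by simp
  qed
  have two: "card (f - I) = 2" if "f \<in> H" "f \<inter> I \<noteq> {}" "f \<inter> M0 = {}" for f
    using single[OF that] H3 that(1) finI by (simp add: card_Diff_subset_Int)
  define M where "M = M0 \<union> (\<Union>f\<in>F. f - I)"
  have MI: "I \<inter> M = {}" using M0I by (auto simp: M_def)
  have finM: "finite M"
  proof -
    have "finite f" if "f \<in> F" for f using that FH W finite_subset by blast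
    then show ?thesis using finM0 finF by (simp add: M_def)
  qed
  have hit: "e \<inter> M \<noteq> {}" if e: "e \<in> H" "e \<inter> I \<noteq> {}" for e
  proof
    assume eM: "e \<inter> M = {}"
    then have e0: "e \<inter> M0 = {}" by (auto simp: M_def)
    have sep: "(e - I) \<inter> (f - I) = {}" if "f \<in> F" for f
      using eM that unfolding M_def by blast
    \<comment> \<open>An edge missing \<open>M\<close> could be added to \<open>F\<close>, so by
      maximality it is in \<open>F\<close>; but then its vertices outside \<open>I\<close> lie in
      \<open>M\<close>.\<close>
    have "insert e F \<in> \<F>"
      unfolding \<F>_def mem_Collect_eq
    proof (intro conjI ballI impI)
      fix f g assume "f \<in> insert e F" "g \<in> insert e F" "f \<noteq> g"
      then consider "f = e" "g \<in> F" | "g = e" "f \<in> F" | "f \<in> F" "g \<in> F" "f \<noteq> g" by blast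
      then show "(f - I) \<inter> (g - I) = {}"
      proof cases
        case 1
        then show ?thesis using sep by blast
      next
        case 2
        then show ?thesis using sep by blast
      next
        case 3
        then show ?thesis by (rule Fd)
      qed
    qed (use FH Fp e e0 in blast)+
    then have "e \<in> F" using max by blast
    then have "e - I = {}" using eM by (auto simp: M_def)
    then show False using two[OF e e0] by (metis card.empty zero_neq_numeral)
  qed
  have cM: "card M \<le> l * (2 * l + 3) * card I + 2 * card F"
  proof -
    have "card (\<Union>f\<in>F. f - I) \<le> (\<Sum>f\<in>F. card (f - I))" using finF by (rule card_UN_le)
    also have "\<dots> = (\<Sum>f\<in>F. 2)" using two FH Fp by (intro sum.cong) auto
    finally have "card (\<Union>f\<in>F. f - I) \<le> 2 * card F" by simp
    then show ?thesis unfolding M_def using cM0 card_Un_le[of M0 "\<Union>f\<in>F. f - I"] by linarith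
  qed
  show ?thesis
  proof (cases "real (card M) \<le> \<tau> * card I")
    case True
    moreover have "I \<subseteq> W" using I X by blast
    moreover have "\<forall>e\<in>H. e \<inter> I \<noteq> {} \<longrightarrow> e \<inter> M \<noteq> {}" using hit by blast
    ultimately show ?thesis
      using \<open>I \<noteq> {}\<close> MI finM by - (rule disjI1, rule exI[of _ I], rule exI[of _ M], intro conjI)
  next
    case False
    have "\<exists>Y P' \<rho>' d'. linked H K (i + 1) Y P' \<rho>' d' \<and> Y \<subseteq> \<Union>F \<and> card Y = card F \<and>
           P' \<subseteq> P \<union> I \<union> \<Union>F \<and> card P' \<le> card P + card I + card F"
    proof (rule linked_expand[OF lk I(1) finF FH H3])
      show "card (f \<inter> I) = 1" if "f \<in> F" for f
        using Fp[OF that] FH that by (intro single) auto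
      show "f \<inter> P = {}" if "f \<in> F" for f using Fp[OF that] by (auto simp: M0_def)
      show "(f - I) \<inter> (g - I) = {}" if "f \<in> F" "g \<in> F" "f \<noteq> g" for f g using that by (rule Fd)
    qed
    then obtain Y P' \<rho>' d' where Y: "linked H K (i + 1) Y P' \<rho>' d'" "Y \<subseteq> \<Union>F" "card Y = card F"
      "P' \<subseteq> P \<union> I \<union> \<Union>F" "card P' \<le> card P + card I + card F" by (elim exE conjE)
    have YW: "Y \<subseteq> W" using Y(2) FH W(2) by blast
    have "P' \<subseteq> P \<union> W" using Y(4) FH W(2) I X by blast
    then have finP': "finite P'" using P W finite_subset by blast
    have "\<tau> * card I < real (l * (2 * l + 3) * card I + 2 * card F)"
      using False cM by linarith
    also have "\<dots> = real (l * (2 * l + 3)) * card I + 2 * real (card F)" by simp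
    \<comment> \<open>The lower bound on \<tau> makes the contribution of \<open>M0\<close> at most
      half of the left side.\<close>
    also have "\<dots> \<le> \<tau> / 2 * card I + 2 * real (card F)"
      using \<tau> by (intro add_right_mono mult_right_mono) auto
    finally have big: "\<tau> * card I \<le> 4 * real (card F)" by (simp add: field_simps)
    have "0 \<le> real (l * (2 * l + 3))" by simp
    then have "0 \<le> \<tau>" using \<tau> by linarith
    have "\<tau> * card X \<le> \<tau> * real (l * card I)"
      using I(2) \<open>0 \<le> \<tau>\<close> by (intro mult_left_mono of_nat_mono) auto
    also have "\<dots> = l * (\<tau> * card I)" by simp
    also have "\<dots> \<le> l * (4 * real (card F))" using big by (intro mult_left_mono) auto
    finally have grow: "\<tau> * card X \<le> 4 * l * card Y" using Y(3) by simp
    \<comment> \<open>This gives \<open>card Y \<ge> 3 * card X\<close>, which absorbs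
      \<open>card P + card I\<close> and so preserves the invariant
      \<open>card P' \<le> 2 * card Y\<close>.\<close>
    have "12 * l \<le> 2 * (l * (2 * l + 3))"
    proof -
      have "l * 6 \<le> l * (2 * l + 3)" using l(3) by (intro mult_le_mono2) simp
      then show ?thesis by simp
    qed
    then have "real (12 * l) \<le> real (2 * (l * (2 * l + 3)))" by (rule of_nat_mono)
    then have "real (12 * l) \<le> \<tau>" using \<tau> by simp
    then have "real (12 * l) * card X \<le> \<tau> * card X" by (rule mult_right_mono) simp
    then have "real (4 * l) * (3 * real (card X)) \<le> real (4 * l) * real (card Y)"
      using grow by simp
    then have "3 * real (card X) \<le> real (card Y)"
      using l(3) by (subst (asm) mult_le_cancel_left_pos) auto
    then have X3: "3 * card X \<le> card Y" by linarith
    have "card I \<le> card X" using I finX by (intro card_mono) auto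
    then have "card P' \<le> 2 * card Y" using Y(5) P(2) X3 Y(3) by linarith
    moreover have "Y \<noteq> {}" using X3 X(2) finX by auto
    ultimately show ?thesis
      using Y(1) YW finP' grow
      by - (rule disjI2, rule exI[of _ Y], rule exI[of _ P'], rule exI[of _ \<rho>'], rule exI[of _ d'],
          intro conjI)
  qed
qed

text \<open>Density gives a first level of order \<open>\<tau>\<^sup>2\<close>, and if nothing is
  removable each further level gains a factor \<open>\<tau> / (4 * l)\<close>, so level
  \<open>k\<close> would outgrow \<open>W\<close>. Every step spends four avoidable vertices, hence
  the budget \<open>2 * l + 4 * (k - i)\<close> at level \<open>i\<close>.\<close>

lemma dense_imp_removable:
  fixes \<tau> :: real
  assumes W: "finite W" "\<forall>e\<in>H. e \<subseteq> W" and H3: "\<forall>e\<in>H. card e = 3" and l: "3 \<le> l"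
    and k: "k = (l + 1) div 2" and C: "C = 2 * l + 4 * k + 1"
    and free: "\<not> (\<exists>C \<subseteq> H. loose_cycle 3 l C)"
    and \<tau>: "2 * real (l * (2 * l + 3)) \<le> \<tau>"
    and dense: "real (card W) * \<tau>\<^sup>2 < card H"
    and size: "6 * real C ^ 2 * real (4 * l) ^ (k - 1) * card W < \<tau> ^ (k + 1)"
  shows "\<exists>I M. I \<subseteq> W \<and> I \<noteq> {} \<and> I \<inter> M = {} \<and> finite M \<and> real (card M) \<le> \<tau> * card I \<and>
            (\<forall>e\<in>H. e \<inter> I \<noteq> {} \<longrightarrow> e \<inter> M \<noteq> {})"
proof (rule ccontr)
  assume none: "\<not> ?thesis"
  have "0 \<le> real (l * (2 * l + 3))" by simp
  then have \<tau>0: "0 \<le> \<tau>" using \<tau> by linarith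
  have k1: "1 \<le> k" using l k by simp
  have "0 \<le> real (card W) * \<tau>\<^sup>2" by simp
  then have "real (card H) > 0" using dense by linarith
  then have Hne: "H \<noteq> {}" by auto
  have "\<exists>X P \<rho> d. linked H (2 * l + 4 * (k - i)) i X P \<rho> d \<and> X \<subseteq> W \<and> X \<noteq> {} \<and> finite P \<and>
          card P \<le> 2 * card X \<and> \<tau> ^ (i + 1) \<le> 6 * real C ^ 2 * real (4 * l) ^ (i - 1) * card X"
    if "1 \<le> i" "i \<le> k" for i
    using that
  proof (induction i rule: dec_induct)
    case base
    have "C = (2 * l + 4 * (k - 1)) + 5" "2 * l < C" using C k1 by auto
    then obtain X P \<rho> d where X: "linked H (2 * l + 4 * (k - 1)) 1 X P \<rho> d" "X \<subseteq> W" "finite P"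
      "card P \<le> 1 + card X" "card H \<le> 6 * C\<^sup>2 * card W * card X"
      using dense_imp_linked_level[OF W H3 Hne l _ _ free] by metis
    have "card H > 0" using \<open>real (card H) > 0\<close> by simp
    then have pos: "card W > 0" "card X > 0" using X(5) by (auto intro!: Nat.gr0I)
    have "real (card W) * \<tau>\<^sup>2 \<le> real (6 * C\<^sup>2 * card W * card X)"
      using dense X(5) by linarith
    also have "\<dots> = real (card W) * (6 * real C ^ 2 * card X)" by simp
    finally have "\<tau>\<^sup>2 \<le> 6 * real C ^ 2 * card X"
      using pos by (subst (asm) mult_le_cancel_left_pos) auto
    moreover have "card P \<le> 2 * card X" "X \<noteq> {}" using X(4) pos by auto
    moreover from calculation(1)
    have "\<tau> ^ (1 + 1) \<le> 6 * real C ^ 2 * real (4 * l) ^ (1 - 1) * card X"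
      by (simp add: power2_eq_square)
    ultimately show ?case
      using X(1-3)
      by - (rule exI[of _ X], rule exI[of _ P], rule exI[of _ \<rho>], rule exI[of _ d], intro conjI)
  next
    case (step i)
    then obtain X P \<rho> d where X: "linked H (2 * l + 4 * (k - i)) i X P \<rho> d" "X \<subseteq> W" "X \<noteq> {}"
      "finite P" "card P \<le> 2 * card X"
      "\<tau> ^ (i + 1) \<le> 6 * real C ^ 2 * real (4 * l) ^ (i - 1) * card X"
      by auto
    \<comment> \<open>From \<open>i < k\<close>: \<open>2 * i \<le> 2 * k - 2 \<le> l - 1\<close>.
      This limits the number of levels to \<open>k\<close>.\<close>
    have i: "2 * i < l" using step.prems k by presburger
    have K: "2 * l + 4 * (k - i) = (2 * l + 4 * (k - Suc i)) + 4" using step.prems by simp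
    have lk: "linked H ((2 * l + 4 * (k - Suc i)) + 4) i X P \<rho> d" using X(1) K by metis
    have Kl: "2 * l \<le> 2 * l + 4 * (k - Suc i) + 4" by simp
    note dichotomy = linked_level_step[OF lk i Kl l W X(2-5) H3 free \<tau>]
    obtain Y P' \<rho>' d' where Y: "linked H (2 * l + 4 * (k - Suc i)) (i + 1) Y P' \<rho>' d'" "Y \<subseteq> W"
      "Y \<noteq> {}" "finite P'" "card P' \<le> 2 * card Y" "\<tau> * card X \<le> 4 * l * card Y"
      using iffD1[OF disj_imp dichotomy, THEN mp, OF none] by (elim exE conjE)
    have "\<tau> ^ (Suc i + 1) = \<tau> * \<tau> ^ (i + 1)" by simp
    also have "\<dots> \<le> \<tau> * (6 * real C ^ 2 * real (4 * l) ^ (i - 1) * card X)"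
      using X(6) \<tau>0 by (rule mult_left_mono)
    also have "\<dots> = 6 * real C ^ 2 * real (4 * l) ^ (i - 1) * (\<tau> * card X)" by simp
    also have "\<dots> \<le> 6 * real C ^ 2 * real (4 * l) ^ (i - 1) * (real (4 * l) * card Y)"
      using Y(6) by (intro mult_left_mono) auto
    also have "\<dots> = 6 * real C ^ 2 * (real (4 * l) * real (4 * l) ^ (i - 1)) * card Y"
      by (simp only: mult_ac)
    also have "real (4 * l) * real (4 * l) ^ (i - 1) = real (4 * l) ^ (Suc i - 1)"
      using step.hyps by (simp add: power_eq_if)
    finally show ?case
      using Y(1-5) unfolding Suc_eq_plus1[symmetric]
      by - (rule exI[of _ Y], rule exI[of _ P'], rule exI[of _ \<rho>'], rule exI[of _ d'], intro conjI)
  qed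
  from this[OF k1 order_refl] obtain X :: "'a set" where
    X: "X \<subseteq> W" "\<tau> ^ (k + 1) \<le> 6 * real C ^ 2 * real (4 * l) ^ (k - 1) * card X"
    by blast
  have "6 * real C ^ 2 * real (4 * l) ^ (k - 1) * card X \<le>
        6 * real C ^ 2 * real (4 * l) ^ (k - 1) * card W"
    using card_mono[OF W(1) X(1)] by (intro mult_left_mono) auto
  then show False using X(2) size by linarith
qed

section \<open>Iterated removal and the Ramsey bound\<close>

text \<open>In the dense case \<open>I0\<close> is kept, \<open>M\<close> is discarded and the rest
  is treated recursively. An edge inside \<open>I0 \<union> I'\<close> misses \<open>M\<close>, so
  it cannot meet \<open>I0\<close> and would lie in \<open>I'\<close>. Since \<open>N\<close> stays
  fixed, the size condition is inherited.\<close>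

lemma large_independent_set:
  fixes \<tau> :: real
  assumes H3: "\<forall>e\<in>H. card e = 3" and l: "3 \<le> l"
    and k: "k = (l + 1) div 2" and C: "C = 2 * l + 4 * k + 1"
    and free: "\<not> (\<exists>C \<subseteq> H. loose_cycle 3 l C)"
    and \<tau>: "2 * real (l * (2 * l + 3)) \<le> \<tau>"
    and size: "6 * real C ^ 2 * real (4 * l) ^ (k - 1) * N < \<tau> ^ (k + 1)"
    and W: "finite W" "real (card W) \<le> N"
  shows "\<exists>I \<subseteq> W. (\<forall>e\<in>H. \<not> e \<subseteq> I) \<and> real (card W) \<le> 4 * \<tau> * real (card I)"
  using W
proof (induction "card W" arbitrary: W rule: less_induct)
  case less
  have "1 \<le> l * (2 * l + 3)" using l by simp
  then have "1 \<le> real (l * (2 * l + 3))" by linarith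
  then have \<tau>1: "1 \<le> \<tau>" using \<tau> by linarith
  define G where "G = {e \<in> H. e \<subseteq> W}"
  have G: "\<forall>e\<in>G. e \<subseteq> W" "\<forall>e\<in>G. card e = 3" using H3 by (auto simp: G_def)
  show ?case
  proof (cases "real (card G) \<le> real (card W) * \<tau>\<^sup>2")
    case True
    obtain I where "I \<subseteq> W" "\<forall>e\<in>G. \<not> e \<subseteq> I" "real (card W) \<le> 4 * \<tau> * real (card I)"
      using sparse_imp_large_independent[OF less.prems(1) G \<tau>1 True] by blast
    moreover have "\<forall>e\<in>H. \<not> e \<subseteq> I" using calculation unfolding G_def by blast
    ultimately show ?thesis by blast
  next
    case False
    have "6 * real C ^ 2 * real (4 * l) ^ (k - 1) * card W \<le>
          6 * real C ^ 2 * real (4 * l) ^ (k - 1) * N"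
      using less.prems(2) by (intro mult_left_mono) auto
    then have sz: "6 * real C ^ 2 * real (4 * l) ^ (k - 1) * card W < \<tau> ^ (k + 1)"
      using size by linarith
    have "\<not> (\<exists>C \<subseteq> G. loose_cycle 3 l C)" using free by (auto simp: G_def)
    then obtain I0 M where I0: "I0 \<subseteq> W" "I0 \<noteq> {}" "I0 \<inter> M = {}" "finite M"
      "real (card M) \<le> \<tau> * card I0" "\<forall>e\<in>G. e \<inter> I0 \<noteq> {} \<longrightarrow> e \<inter> M \<noteq> {}"
      using dense_imp_removable[OF less.prems(1) G l k C _ \<tau> _ sz] False by auto
    define W' where "W' = W - (I0 \<union> M)"
    have "W' \<subset> W" using I0 by (auto simp: W'_def)
    then have "card W' < card W" using less.prems(1) by (intro psubset_card_mono)
    moreover have "finite W'" using less.prems(1) by (simp add: W'_def)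
    ultimately obtain I' where I': "I' \<subseteq> W'" "\<forall>e\<in>H. \<not> e \<subseteq> I'"
      "real (card W') \<le> 4 * \<tau> * real (card I')"
      using less.hyps[of W'] less.prems(2) by auto
    have fin: "finite I0" "finite I'"
      using less.prems(1) I0(1) I'(1) \<open>finite W'\<close> by (auto dest: finite_subset)
    have "\<not> e \<subseteq> I0 \<union> I'" if "e \<in> H" for e
    proof
      assume e: "e \<subseteq> I0 \<union> I'"
      then have "e \<in> G" using that I0(1) I'(1) by (auto simp: G_def W'_def)
      moreover have "e \<inter> M = {}" using e I0(3) I'(1) by (auto simp: W'_def)
      ultimately have "e \<inter> I0 = {}" using I0(6) by blast
      then show False using e I'(2) that by blast
    qed
    moreover have "real (card W) \<le> 4 * \<tau> * real (card (I0 \<union> I'))"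
    proof -
      have "card W \<le> card (W' \<union> (I0 \<union> M))"
        using \<open>finite W'\<close> fin I0(4) by (intro card_mono) (auto simp: W'_def)
      also have "\<dots> \<le> card W' + (card I0 + card M)"
        by (meson add_left_mono card_Un_le le_trans)
      finally have "real (card W) \<le> real (card W') + (real (card I0) + real (card M))" by linarith
      \<comment> \<open>Both \<open>card I0\<close> and \<open>card M\<close> are at most
        \<open>\<tau> * card I0\<close>, so the removed vertices cost less than the allowed
        \<open>4 * \<tau>\<close> per kept vertex.\<close>
      also have "\<dots> \<le> 4 * \<tau> * card I' + (\<tau> * card I0 + \<tau> * card I0)"
        using I'(3) I0(5) \<tau>1 mult_right_mono[OF \<tau>1, of "real (card I0)"] by (intro add_mono) auto
      also have "\<dots> \<le> 4 * \<tau> * (real (card I0) + real (card I'))"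
        using \<tau>1 by (simp add: algebra_simps)
      also have "real (card I0) + real (card I') = real (card (I0 \<union> I'))"
      proof -
        have "I0 \<inter> I' = {}" using I'(1) by (auto simp: W'_def)
        then show ?thesis using fin by (simp add: card_Un_disjoint)
      qed
      finally show ?thesis .
    qed
    ultimately show ?thesis using I0(1) I'(1) by (intro exI[of _ "I0 \<union> I'"]) (auto simp: W'_def)
  qed
qed

text \<open>With \<tau> of order \<open>n powr (1 / k)\<close> and \<open>N\<close> about
  \<open>4 * \<tau> * n\<close>, an independent set of size at least \<open>N / (4 * \<tau>)\<close>
  has at least \<open>n\<close> vertices.\<close>

lemma ramsey_cycle_clique_bound:
  assumes l: "3 \<le> l" and k: "k = (l + 1) div 2"
  shows "\<exists>c::real. c > 0 \<and> (\<forall>n::nat. real (ramsey_cycle_clique 3 l n) \<le> c * real n powr (1 + 1 / real k))"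
proof -
  define C where "C = 2 * l + 4 * k + 1"
  define D where "D = 6 * real C ^ 2 * real (4 * l) ^ (k - 1)"
  \<comment> \<open>The first summand serves the size condition, where rounding
    \<open>4 * \<tau> * n\<close> up to \<open>N\<close> turns 4 into 5; the last one serves the
    lower bound on \<tau>.\<close>
  define A where "A = 5 * D + 1 + 2 * real (l * (2 * l + 3))"
  have k1: "1 \<le> k" using l k by simp
  have D0: "0 \<le> D" by (simp add: D_def)
  have "0 \<le> real (l * (2 * l + 3))" by simp
  then have A1: "1 \<le> A" "5 * D < A" "2 * real (l * (2 * l + 3)) \<le> A"
    using D0 unfolding A_def by linarith+
  have bound: "real (ramsey_cycle_clique 3 l n) \<le> 5 * A * real n powr (1 + 1 / real k)" for n
  proof (cases "n = 0")
    case True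
    \<comment> \<open>For \<open>n = 0\<close> the right side is 0, as \<open>0 powr x = 0\<close>,
      so the Ramsey number itself must vanish; the empty set is the blue clique.\<close>
    have "cycle_clique_arrows 3 l 0 0" by (auto simp: cycle_clique_arrows_def nsets_def)
    then have "ramsey_cycle_clique 3 l 0 \<le> 0" unfolding ramsey_cycle_clique_def by (rule Least_le)
    then show ?thesis using True by simp
  next
    case False
    then have n1: "1 \<le> real n" by simp
    define \<tau> where "\<tau> = A * real n powr (1 / real k)"
    have "1 \<le> real n powr (1 / real k)" using n1 by (intro ge_one_powr_ge_zero) auto
    then have A\<tau>: "A \<le> \<tau>"
      using A1(1) mult_left_mono[of 1 "real n powr (1 / real k)" A] unfolding \<tau>_def by simp
    have \<tau>n: "\<tau> * n = A * real n powr (1 + 1 / real k)"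
      using n1 by (simp add: \<tau>_def powr_add)
    define N where "N = nat \<lceil>4 * \<tau> * n\<rceil>"
    have "1 * 1 \<le> \<tau> * real n" using A\<tau> A1(1) n1 by (intro mult_mono) auto
    then have N: "4 * \<tau> * n \<le> real N" "real N \<le> 5 * (\<tau> * n)"
      unfolding N_def by linarith+
    have size: "D * real N < \<tau> ^ (k + 1)"
    proof -
      have "D * real N \<le> D * (5 * (\<tau> * n))" using N(2) D0 by (rule mult_left_mono)
      also have "\<dots> = 5 * D * (\<tau> * n)" by simp
      also have "\<dots> < A * (\<tau> * n)"
        using A1(2) \<open>1 * 1 \<le> \<tau> * real n\<close> by (intro mult_strict_right_mono) auto
      \<comment> \<open>Raising \<open>A\<close> to the power \<open>k\<close> lets it combine with
        \<open>n\<close>, the \<open>k\<close>-th power of \<open>n powr (1 / k)\<close>, to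
        \<open>\<tau> ^ k\<close>.\<close>
      also have "\<dots> \<le> A ^ k * (\<tau> * n)"
        using A1(1) k1 \<open>1 * 1 \<le> \<tau> * real n\<close> by (intro mult_right_mono self_le_power) auto
      also have "\<dots> = \<tau> * (A ^ k * n)" by simp
      also have "real n = (real n powr (1 / real k)) ^ k"
        using n1 k1 by (simp add: powr_realpow[symmetric] powr_powr)
      also have "A ^ k * (real n powr (1 / real k)) ^ k = \<tau> ^ k"
        by (simp add: \<tau>_def power_mult_distrib)
      finally show ?thesis by simp
    qed
    have "cycle_clique_arrows 3 l n N"
      unfolding cycle_clique_arrows_def
    proof (intro allI impI)
      fix red assume red: "red \<subseteq> [{..<N}]\<^bsup>3\<^esup>"
      show "(\<exists>C\<subseteq>red. loose_cycle 3 l C) \<or>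
            (\<exists>S\<subseteq>{..<N}. card S = n \<and> [S]\<^bsup>3\<^esup> \<subseteq> [{..<N}]\<^bsup>3\<^esup> - red)"
      proof (cases "\<exists>C\<subseteq>red. loose_cycle 3 l C")
        case False
        have "\<forall>e\<in>red. card e = 3" using red by (auto simp: nsets_def)
        moreover have "2 * real (l * (2 * l + 3)) \<le> \<tau>" using A1(3) A\<tau> by linarith
        ultimately obtain I where I: "I \<subseteq> {..<N}" "\<forall>e\<in>red. \<not> e \<subseteq> I"
          "real (card {..<N}) \<le> 4 * \<tau> * real (card I)"
          using large_independent_set[OF _ l k C_def False _ size[unfolded D_def], of "{..<N}"]
          by auto
        have "4 * \<tau> * n \<le> 4 * \<tau> * real (card I)" using I(3) N(1) by simp
        then have "n \<le> card I" using A\<tau> A1(1) by (subst (asm) mult_le_cancel_left_pos) auto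
        then obtain S where S: "S \<subseteq> I" "card S = n" by (meson obtain_subset_with_card_n)
        have "[S]\<^bsup>3\<^esup> \<subseteq> [{..<N}]\<^bsup>3\<^esup> - red"
          using S(1) I(1,2) unfolding nsets_def by blast
        then show ?thesis using S I(1) by blast
      qed simp
    qed
    then have "ramsey_cycle_clique 3 l n \<le> N" unfolding ramsey_cycle_clique_def by (rule Least_le)
    then have "real (ramsey_cycle_clique 3 l n) \<le> 5 * (\<tau> * n)" using N(2) by linarith
    then show ?thesis using \<tau>n by simp
  qed
  then show ?thesis using A1(1) by (intro exI[of _ "5 * A"]) auto
qed

theorem theorem1p5:
  shows "(\<exists>c::real. c > 0 \<and>
            (\<forall>n::nat. real (ramsey_cycle_clique 3 5 n) \<le> c * real n powr (4 / 3))) \<and>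
         (\<forall>l::nat. l \<ge> 3 \<longrightarrow>
            (\<exists>c::real. c > 0 \<and>
               (\<forall>n::nat. real (ramsey_cycle_clique 3 l n)
                  \<le> c * real n powr (1 + 1 / real ((l + 1) div 2)))))"
proof (intro conjI allI impI)
  show "\<exists>c::real. c > 0 \<and> (\<forall>n::nat. real (ramsey_cycle_clique 3 5 n) \<le> c * real n powr (4 / 3))"
  proof -
    have exponent: "1 + 1 / real 3 = 4 / 3" by simp
    have "(3::nat) \<le> 5" "(3::nat) = (5 + 1) div 2" by simp_all
    from ramsey_cycle_clique_bound[OF this] show ?thesis unfolding exponent .
  qed
qed (rule ramsey_cycle_clique_bound[OF _ refl])

end
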